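(* Let $k\ge0$ be an integer and $J\subseteq\mathcal L(X)$ a nonempty upper set. Then $\mathcal B(X,k,J)$ is a basis of $\mathcal P(X,k,J)$.
   Context: Let $\mathbb{K}$ be a field of characteristic zero, $U$ a $\mathbb K$-vector space of dimension $r\ge1$, and $X=(x_1,\dots,x_N)$ a finite sequence in $U$ spanning $U$, ordered by $x_i<x_j$ iff $i<j$. Subsequences are taken with respect to indices; $X\setminus Y$ is the complementary subsequence. $\operatorname{rank}(Y)$ is the dimension of the span; $\operatorname{clos}(Y)=\{z\in X:\operatorname{rank}(Y\cup z)=\operatorname{rank}(Y)\}$; flats are $C$ with $\operatorname{clos}(C)=C$; $\mathcal L(X)$ is the lattice of flats. An upper set $J$ is closed under passing to larger flats; $\chi=\chi_J$ is its indicator, extended by $\chi(A)=\chi(\operatorname{clos}(A))$ for $A\subseteq X$. $p_u$ is the image of $u\in U$ in $\operatorname{Sym}(U)$, $p_Y=\prod_{z\in Y}p_z$. For $k\ge1$, $S(X,k,J)=\{fp_Y: Y\subseteq X,\ f\in\operatorname{Sym}(U),\ \deg f\le\chi(X\setminus Y)+k-1\}$, $S(X,0,J)=\{p_Y:Y\subseteq X,\ \operatorname{clos}(X\setminus Y)\in J\}$, and $\mathcal P(X,k,J)=\operatorname{span}S(X,k,J)$. $\mathbb B(X)$ is the set of bases of $X$ (subsequences of cardinality $r$ and rank $r$). For $B\in\mathbb B(X)$, $b\in B$ is internally active if $b=\max(X\setminus\operatorname{clos}(B\setminus b))$; $I(B)$ is the set of internally active elements. $z\in X\setminus B$ is externally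 active if $z\in\operatorname{clos}\{b\in B: b\le z\}$; $E(B)$ is the set of externally active elements. Define $\Gamma(X,k,J)=\{(B,I,\mathbf a): B\in\mathbb B(X),\ I\subseteq I(B),\ \mathbf a\in\mathbb N^I,\ \sum_{z\in I}a_z\le k+\chi((B\cup E(B))\setminus I)-1\}$ and $\mathcal B(X,k,J)=\{p_{X\setminus(B\cup E(B))}\prod_{z\in I}p_z^{a_z+1}:(B,I,\mathbf a)\in\Gamma(X,k,J)\}\subseteq\operatorname{Sym}(U)$. *)

theory Defs
  imports Complex_Main "HOL-Library.Poly_Mapping" "HOL-Library.FuncSet"
begin

section \<open>The symmetric algebra\<close>

text \<open>
  The locale \<open>symmetric_algebra\<close> below adds no assumption to the library locale
  \<open>finite_dimensional_vector_space\<close>, which describes a finite-dimensional \<open>U\<close> and carries an arbitrary basis \<open>Basis\<close> of \<open>U\<close>.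
  \<open>Sym U\<close> is realised as the polynomial ring over \<open>K\<close> in the elements of \<open>Basis\<close>. A polynomial
  is an element of \<open>('u \<Rightarrow>\<^sub>0 nat) \<Rightarrow>\<^sub>0 'k\<close>: the inner finitely supported functions are the exponent
  vectors of monomials, and the ring structure is that of the library. Since the type \<open>'u\<close> may
  contain further vectors, \<open>Sym\<close> is the set of those polynomials in which only elements
  of \<open>Basis\<close> occur. The map \<open>lin\<close> is the canonical embedding of \<open>U\<close> (so \<open>lin u\<close> is \<open>p\<^sub>u\<close>).
  That \<open>Sym\<close> with \<open>lin\<close> is the symmetric algebra, whatever \<open>Basis\<close> is, is the universal property
  \<open>Sym_universal_existence\<close>, \<open>Sym_universal_uniqueness\<close> below.
\<close>

definition poly_scale ::
    "'k::comm_ring_1 \<Rightarrow> (('u \<Rightarrow>\<^sub>0 nat) \<Rightarrow>\<^sub>0 'k) \<Rightarrow> (('u \<Rightarrow>\<^sub>0 nat) \<Rightarrow>\<^sub>0 'k)" where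
  "poly_scale c f = Poly_Mapping.map ((*) c) f"

text \<open>The zero polynomial satisfies \<open>deg_le f d\<close> for all \<open>d\<close>, that is, it has degree minus infinity.\<close>

definition deg_le :: "(('u \<Rightarrow>\<^sub>0 nat) \<Rightarrow>\<^sub>0 'k::zero) \<Rightarrow> nat \<Rightarrow> bool" where
  "deg_le f d \<longleftrightarrow>
     (\<forall>m\<in>Poly_Mapping.keys f. (\<Sum>b\<in>Poly_Mapping.keys m. Poly_Mapping.lookup m b) \<le> d)"

locale symmetric_algebra = finite_dimensional_vector_space scale Basis
  for scale :: "'a::field \<Rightarrow> 'b::ab_group_add \<Rightarrow> 'b" and Basis :: "'b set"
begin

definition Sym :: "(('b \<Rightarrow>\<^sub>0 nat) \<Rightarrow>\<^sub>0 'a) set" where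
  "Sym = {f. \<forall>m\<in>Poly_Mapping.keys f. Poly_Mapping.keys m \<subseteq> Basis}"

definition lin :: "'b \<Rightarrow> (('b \<Rightarrow>\<^sub>0 nat) \<Rightarrow>\<^sub>0 'a)" where
  "lin u = (\<Sum>b\<in>Basis. Poly_Mapping.single (Poly_Mapping.single b 1) (representation Basis u b))"

end

lemma poly_scale_conv_mult: "poly_scale c f = Poly_Mapping.single 0 c * f"
  unfolding poly_scale_def by (rule mult_map_scale_conv_mult)

lemma lookup_poly_scale [simp]:
  "Poly_Mapping.lookup (poly_scale c f) m = c * Poly_Mapping.lookup f m"
  unfolding poly_scale_def by (simp add: Poly_Mapping.map.rep_eq when_def)

lemma vector_space_poly_scale:
  "vector_space (poly_scale :: 'k::field \<Rightarrow> (('u \<Rightarrow>\<^sub>0 nat) \<Rightarrow>\<^sub>0 'k) \<Rightarrow> _)"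
  by unfold_locales
    (auto intro!: poly_mapping_eqI simp: lookup_add algebra_simps)

subsection \<open>Universal property\<close>

lemma poly_expand:
  fixes f :: "'a \<Rightarrow>\<^sub>0 'c::comm_monoid_add"
  shows "f = (\<Sum>m\<in>Poly_Mapping.keys f. Poly_Mapping.single m (Poly_Mapping.lookup f m))"
proof (rule poly_mapping_eqI)
  fix k
  show "Poly_Mapping.lookup f k =
    Poly_Mapping.lookup (\<Sum>m\<in>Poly_Mapping.keys f. Poly_Mapping.single m (Poly_Mapping.lookup f m)) k"
    by (simp add: lookup_sum lookup_single when_def in_keys_iff)
qed

lemma single_power:
  "Poly_Mapping.single (Poly_Mapping.single b (Suc 0)) (1::'k::comm_ring_1) ^ n
     = Poly_Mapping.single (Poly_Mapping.single b n) 1"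
  by (induction n) (simp_all add: mult_single single_add[symmetric])

lemma prod_single:
  "(\<Prod>b\<in>A. Poly_Mapping.single (g b) (1::'k::comm_ring_1)) = Poly_Mapping.single (\<Sum>b\<in>A. g b) 1"
  by (induction A rule: infinite_finite_induct) (simp_all add: mult_single)

lemma monom_prod:
  fixes m :: "'u \<Rightarrow>\<^sub>0 nat"
  shows "Poly_Mapping.single m (1::'k::comm_ring_1) =
    (\<Prod>b\<in>Poly_Mapping.keys m.
       Poly_Mapping.single (Poly_Mapping.single b (Suc 0)) 1 ^ Poly_Mapping.lookup m b)"
  by (simp add: single_power prod_single poly_expand[of m, symmetric])

context symmetric_algebra
begin

lemma lin_basis:
  assumes "b \<in> Basis"
  shows "lin b = Poly_Mapping.single (Poly_Mapping.single b 1) 1"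
proof -
  have "lin b = (\<Sum>c\<in>Basis. if c = b then Poly_Mapping.single (Poly_Mapping.single b 1) 1 else 0)"
    unfolding lin_def
    by (rule sum.cong) (use assms in \<open>auto simp: representation_basis independent_Basis\<close>)
  also have "\<dots> = Poly_Mapping.single (Poly_Mapping.single b 1) 1"
    using assms by (simp add: finite_Basis)
  finally show ?thesis .
qed

lemma lin_add: "lin (u + v) = lin u + lin v"
  unfolding lin_def
  by (simp add: representation_add independent_Basis span_Basis single_add sum.distrib)

lemma lin_scale: "lin (scale c u) = poly_scale c (lin u)"
  unfolding lin_def
  by (simp add: representation_scale independent_Basis span_Basis poly_scale_conv_mult
      sum_distrib_left mult_single)

lemma Sym_subalgebra:
  "0 \<in> Sym" "1 \<in> Sym" "lin u \<in> Sym"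
  "f \<in> Sym \<Longrightarrow> g \<in> Sym \<Longrightarrow> f + g \<in> Sym"
  "f \<in> Sym \<Longrightarrow> g \<in> Sym \<Longrightarrow> f * g \<in> Sym"
  "f \<in> Sym \<Longrightarrow> poly_scale c f \<in> Sym"
proof -
  show zero: "0 \<in> Sym" and one: "1 \<in> Sym" by (simp_all add: Sym_def)
  show add: "f + g \<in> Sym" if "f \<in> Sym" "g \<in> Sym" for f g
    using that keys_add[of f g] unfolding Sym_def by blast
  show mul: "f * g \<in> Sym" if "f \<in> Sym" "g \<in> Sym" for f g
  proof -
    have "Poly_Mapping.keys (a + b) \<subseteq> Basis"
      if "a \<in> Poly_Mapping.keys f" "b \<in> Poly_Mapping.keys g" for a b
      using that \<open>f \<in> Sym\<close> \<open>g \<in> Sym\<close> keys_add[of a b] unfolding Sym_def by blast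
    then show ?thesis
      using keys_mult[of f g] unfolding Sym_def by blast
  qed
  show "f \<in> Sym \<Longrightarrow> poly_scale c f \<in> Sym"
    by (auto simp: Sym_def in_keys_iff)
  have sg: "Poly_Mapping.single (Poly_Mapping.single b 1) c \<in> Sym" if "b \<in> Basis" for b c
    using that by (simp add: Sym_def)
  have "(\<Sum>b\<in>A. Poly_Mapping.single (Poly_Mapping.single b 1) (h b)) \<in> Sym" if "A \<subseteq> Basis" for A h
    using finite_subset[OF that finite_Basis] that
    by (induction A rule: finite_induct) (simp_all add: zero add sg[simplified])
  then show "lin u \<in> Sym" unfolding lin_def by blast
qed

text \<open>
  In the following two lemmas, \<open>sA\<close> makes the commutative ring \<open>'c\<close> an algebra over the ground
  field, and \<open>\<phi>\<close> is a linear map from \<open>U\<close> to it.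
\<close>

lemma Sym_universal_existence:
  fixes sA :: "'a \<Rightarrow> 'c::comm_ring_1 \<Rightarrow> 'c"
  assumes sA: "vector_space sA" and sA_mult: "\<And>c x y. sA c (x * y) = sA c x * y"
    and add: "\<And>u v. \<phi> (u + v) = \<phi> u + \<phi> v" and sc: "\<And>c u. \<phi> (scale c u) = sA c (\<phi> u)"
  shows "\<exists>\<Phi>. (\<forall>u. \<Phi> (lin u) = \<phi> u) \<and> \<Phi> 1 = 1 \<and>
     (\<forall>f g. \<Phi> (f + g) = \<Phi> f + \<Phi> g) \<and> (\<forall>f g. \<Phi> (f * g) = \<Phi> f * \<Phi> g) \<and>
     (\<forall>c f. \<Phi> (poly_scale c f) = sA c (\<Phi> f))"
proof -
  interpret A: vector_space sA by (rule sA)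
  define M :: "('b \<Rightarrow>\<^sub>0 nat) \<Rightarrow> 'c"
    where "M m = (\<Prod>b\<in>Poly_Mapping.keys m. \<phi> b ^ Poly_Mapping.lookup m b)" for m
  define \<Phi> :: "(('b \<Rightarrow>\<^sub>0 nat) \<Rightarrow>\<^sub>0 'a) \<Rightarrow> 'c"
    where "\<Phi> f = (\<Sum>m\<in>Poly_Mapping.keys f. sA (Poly_Mapping.lookup f m) (M m))" for f
  have M_sup: "M m = (\<Prod>b\<in>S. \<phi> b ^ Poly_Mapping.lookup m b)"
    if "finite S" "Poly_Mapping.keys m \<subseteq> S" for m S
    unfolding M_def using that by (intro prod.mono_neutral_left) (auto simp: in_keys_iff)
  have M_add: "M (m + n) = M m * M n" for m n
  proof -
    let ?S = "Poly_Mapping.keys m \<union> Poly_Mapping.keys n"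
    have "M (m + n) = (\<Prod>b\<in>?S. \<phi> b ^ Poly_Mapping.lookup (m + n) b)"
      by (rule M_sup) (simp_all add: keys_add)
    also have "\<dots> = (\<Prod>b\<in>?S. \<phi> b ^ Poly_Mapping.lookup m b) * (\<Prod>b\<in>?S. \<phi> b ^ Poly_Mapping.lookup n b)"
      by (simp add: lookup_add power_add prod.distrib)
    also have "\<dots> = M m * M n"
      by (subst (1 2) M_sup[of ?S]) simp_all
    finally show ?thesis .
  qed
  have \<Phi>_sup: "\<Phi> f = (\<Sum>m\<in>S. sA (Poly_Mapping.lookup f m) (M m))"
    if "finite S" "Poly_Mapping.keys f \<subseteq> S" for f S
    unfolding \<Phi>_def using that by (intro sum.mono_neutral_left) (auto simp: in_keys_iff)
  have \<Phi>_add: "\<Phi> (f + g) = \<Phi> f + \<Phi> g" for f g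
  proof -
    let ?S = "Poly_Mapping.keys f \<union> Poly_Mapping.keys g"
    have "\<Phi> (f + g) = (\<Sum>m\<in>?S. sA (Poly_Mapping.lookup (f + g) m) (M m))"
      by (rule \<Phi>_sup) (simp_all add: keys_add)
    also have "\<dots> = (\<Sum>m\<in>?S. sA (Poly_Mapping.lookup f m) (M m)) + (\<Sum>m\<in>?S. sA (Poly_Mapping.lookup g m) (M m))"
      by (simp add: lookup_add A.scale_left_distrib sum.distrib)
    also have "\<dots> = \<Phi> f + \<Phi> g"
      by (subst (1 2) \<Phi>_sup[of ?S]) simp_all
    finally show ?thesis .
  qed
  have \<Phi>_single: "\<Phi> (Poly_Mapping.single m c) = sA c (M m)" for m c
    by (cases "c = 0") (simp_all add: \<Phi>_def)
  have \<Phi>_0: "\<Phi> 0 = 0" by (simp add: \<Phi>_def)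
  have \<Phi>_sum: "\<Phi> (\<Sum>i\<in>S. h i) = (\<Sum>i\<in>S. \<Phi> (h i))" for S and h :: "'i \<Rightarrow> _"
    by (induction S rule: infinite_finite_induct) (simp_all add: \<Phi>_0 \<Phi>_add)
  have sA_mult': "sA c x * sA d y = sA (c * d) (x * y)" for c d x y
    by (metis A.scale_scale mult.commute sA_mult)
  have \<Phi>_mult: "\<Phi> (f * g) = \<Phi> f * \<Phi> g" for f g
  proof -
    have "f * g = (\<Sum>m\<in>Poly_Mapping.keys f. \<Sum>n\<in>Poly_Mapping.keys g.
        Poly_Mapping.single (m + n) (Poly_Mapping.lookup f m * Poly_Mapping.lookup g n))"
      by (subst poly_expand[of f], subst poly_expand[of g]) (simp add: sum_product mult_single)
    then have "\<Phi> (f * g) = (\<Sum>m\<in>Poly_Mapping.keys f. \<Sum>n\<in>Poly_Mapping.keys g.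
        sA (Poly_Mapping.lookup f m) (M m) * sA (Poly_Mapping.lookup g n) (M n))"
      by (simp add: \<Phi>_sum \<Phi>_single M_add sA_mult')
    also have "\<dots> = \<Phi> f * \<Phi> g"
      by (simp add: \<Phi>_def sum_product)
    finally show ?thesis .
  qed
  have \<Phi>_1: "\<Phi> 1 = 1"
    using \<Phi>_single[of 0 1] by (simp add: M_def)
  have \<Phi>_scale: "\<Phi> (poly_scale c f) = sA c (\<Phi> f)" for c f
    unfolding poly_scale_conv_mult \<Phi>_mult \<Phi>_single
    by (simp add: M_def sA_mult[symmetric])
  have \<phi>0: "\<phi> 0 = 0"
    using add[of 0 0] by simp
  have \<phi>_sum: "\<phi> (\<Sum>i\<in>S. h i) = (\<Sum>i\<in>S. \<phi> (h i))" for S and h :: "'b \<Rightarrow> _"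
    by (induction S rule: infinite_finite_induct) (simp_all add: \<phi>0 add)
  have "\<Phi> (lin u) = \<phi> u" for u
  proof -
    have "\<Phi> (lin u) = (\<Sum>b\<in>Basis. sA (representation Basis u b) (\<phi> b))"
      unfolding lin_def \<Phi>_sum \<Phi>_single by (simp add: M_def)
    also have "\<dots> = \<phi> (\<Sum>b\<in>Basis. scale (representation Basis u b) b)"
      by (simp add: \<phi>_sum sc)
    also have "(\<Sum>b\<in>Basis. scale (representation Basis u b) b) = u"
      by (rule sum_representation_eq) (simp_all add: independent_Basis span_Basis finite_Basis)
    finally show ?thesis .
  qed
  with \<Phi>_1 \<Phi>_add \<Phi>_mult \<Phi>_scale show ?thesis by blast
qed

lemma Sym_universal_uniqueness:
  fixes sA :: "'a \<Rightarrow> 'c::comm_ring_1 \<Rightarrow> 'c"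
  assumes "\<forall>\<Phi>\<in>{\<Phi>1, \<Phi>2}. (\<forall>u. \<Phi> (lin u) = \<phi> u) \<and> \<Phi> 1 = 1 \<and>
       (\<forall>f\<in>Sym. \<forall>g\<in>Sym. \<Phi> (f + g) = \<Phi> f + \<Phi> g) \<and> (\<forall>f\<in>Sym. \<forall>g\<in>Sym. \<Phi> (f * g) = \<Phi> f * \<Phi> g) \<and>
       (\<forall>c. \<forall>f\<in>Sym. \<Phi> (poly_scale c f) = sA c (\<Phi> f))"
    and "f \<in> Sym"
  shows "\<Phi>1 f = \<Phi>2 f"
proof -
  define E where "E = {f \<in> Sym. \<Phi>1 f = \<Phi>2 f}"
  have E1: "1 \<in> E" and El: "lin u \<in> E" and Ea: "f \<in> E \<Longrightarrow> g \<in> E \<Longrightarrow> f + g \<in> E"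
    and Em: "f \<in> E \<Longrightarrow> g \<in> E \<Longrightarrow> f * g \<in> E" and Es: "f \<in> E \<Longrightarrow> poly_scale c f \<in> E" for u f g c
    using assms(1) by (auto simp: E_def Sym_subalgebra)
  have E0: "0 \<in> E"
    using Es[OF E1, of 0] by (simp add: poly_scale_conv_mult)
  have Ep: "g ^ n \<in> E" if "g \<in> E" for g n
    by (induction n) (simp_all add: E1 Em that)
  have Eprod: "(\<Prod>b\<in>S. h b) \<in> E" if "\<And>b. b \<in> S \<Longrightarrow> h b \<in> E" for S and h :: "'b \<Rightarrow> _"
    using that by (induction S rule: infinite_finite_induct) (auto intro: E1 Em)
  have Esum: "(\<Sum>b\<in>S. h b) \<in> E" if "\<And>b. b \<in> S \<Longrightarrow> h b \<in> E" for S and h :: "('b \<Rightarrow>\<^sub>0 nat) \<Rightarrow> _"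
    using that by (induction S rule: infinite_finite_induct) (auto intro: E0 Ea)
  have "Poly_Mapping.single m c \<in> E" if "Poly_Mapping.keys m \<subseteq> Basis" for m c
  proof -
    have "Poly_Mapping.single m (1::'a) \<in> E"
      unfolding monom_prod[of m]
      by (intro Eprod Ep) (use that El lin_basis in \<open>auto, metis subsetD\<close>)
    from Es[OF this, of c] show ?thesis
      by (simp add: poly_scale_conv_mult mult_single)
  qed
  then have "(\<Sum>m\<in>Poly_Mapping.keys f. Poly_Mapping.single m (Poly_Mapping.lookup f m)) \<in> E"
    using assms(2) by (intro Esum) (auto simp: Sym_def)
  then show ?thesis
    unfolding poly_expand[of f, symmetric] by (simp add: E_def)
qed

end

section \<open>The matroid of a finite sequence of vectors\<close>

text \<open>
  A finite sequence in \<open>U\<close> is a list \<open>X\<close>. Its subsequences are represented by their sets of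
  positions, that is, by subsets of \<open>{..<length X}\<close>; the order on \<open>X\<close> is the order of positions.
\<close>

context symmetric_algebra
begin

definition seq_rank :: "'b list \<Rightarrow> nat set \<Rightarrow> nat" where
  "seq_rank X Y = dim (span ((!) X ` Y))"

definition clos :: "'b list \<Rightarrow> nat set \<Rightarrow> nat set" where
  "clos X Y = {z \<in> {..<length X}. seq_rank X (Y \<union> {z}) = seq_rank X Y}"

definition flats :: "'b list \<Rightarrow> nat set set" where
  "flats X = {C. C \<subseteq> {..<length X} \<and> clos X C = C}"

definition is_upper_set :: "'b list \<Rightarrow> nat set set \<Rightarrow> bool" where
  "is_upper_set X J \<longleftrightarrow>
     J \<subseteq> flats X \<and> (\<forall>C\<in>J. \<forall>D\<in>flats X. C \<subseteq> D \<longrightarrow> D \<in> J)"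

definition chi :: "'b list \<Rightarrow> nat set set \<Rightarrow> nat set \<Rightarrow> nat" where
  "chi X J A = (if clos X A \<in> J then 1 else 0)"

definition seq_bases :: "'b list \<Rightarrow> nat set set" where
  "seq_bases X = {B. B \<subseteq> {..<length X} \<and> card B = dim UNIV \<and> seq_rank X B = dim UNIV}"

definition int_active :: "'b list \<Rightarrow> nat set \<Rightarrow> nat set" where
  "int_active X B = {b \<in> B. b = Max ({..<length X} - clos X (B - {b}))}"

definition ext_active :: "'b list \<Rightarrow> nat set \<Rightarrow> nat set" where
  "ext_active X B = {z \<in> {..<length X} - B. z \<in> clos X {b \<in> B. b \<le> z}}"

text \<open>
  Vectors in \<open>\<nat>\<^sup>I\<close> are functions that are \<open>undefined\<close> outside \<open>I\<close>. The bound on their sum is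
  taken in \<open>int\<close>, because it equals \<open>-1\<close> when \<open>k = 0\<close> and \<open>chi\<close> vanishes.
\<close>

definition Gamma :: "'b list \<Rightarrow> nat \<Rightarrow> nat set set \<Rightarrow> (nat set \<times> nat set \<times> (nat \<Rightarrow> nat)) set" where
  "Gamma X k J = {(B, I, a). B \<in> seq_bases X \<and> I \<subseteq> int_active X B \<and> a \<in> I \<rightarrow>\<^sub>E UNIV \<and>
     int (\<Sum>z\<in>I. a z) \<le> int k + int (chi X J ((B \<union> ext_active X B) - I)) - 1}"

end

section \<open>Hierarchical zonotopal power spaces\<close>

context symmetric_algebra
begin

definition p_seq :: "'b list \<Rightarrow> nat set \<Rightarrow> (('b \<Rightarrow>\<^sub>0 nat) \<Rightarrow>\<^sub>0 'a)" where
  "p_seq X Y = (\<Prod>z\<in>Y. lin (X ! z))"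

definition S_gen :: "'b list \<Rightarrow> nat \<Rightarrow> nat set set \<Rightarrow> (('b \<Rightarrow>\<^sub>0 nat) \<Rightarrow>\<^sub>0 'a) set" where
  "S_gen X k J =
    (if k = 0 then {p_seq X Y | Y. Y \<subseteq> {..<length X} \<and> clos X ({..<length X} - Y) \<in> J}
     else {f * p_seq X Y | f Y. Y \<subseteq> {..<length X} \<and> f \<in> Sym \<and>
             deg_le f (chi X J ({..<length X} - Y) + k - 1)})"

definition P_space :: "'b list \<Rightarrow> nat \<Rightarrow> nat set set \<Rightarrow> (('b \<Rightarrow>\<^sub>0 nat) \<Rightarrow>\<^sub>0 'a) set" where
  "P_space X k J = module.span poly_scale (S_gen X k J)"

definition B_set :: "'b list \<Rightarrow> nat \<Rightarrow> nat set set \<Rightarrow> (('b \<Rightarrow>\<^sub>0 nat) \<Rightarrow>\<^sub>0 'a) set" where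
  "B_set X k J =
    {p_seq X ({..<length X} - (B \<union> ext_active X B)) * (\<Prod>z\<in>I. lin (X ! z) ^ (a z + 1)) | B I a.
       (B, I, a) \<in> Gamma X k J}"

end

end

theory Submission
  imports Defs
begin

text \<open>
  Spanning is a straightening argument on products \<open>f p\<^sub>Y\<close>, with \<open>A = X \<setminus> Y\<close>. If some \<open>e \<notin> A\<close> lies in the
  span of the smaller elements of \<open>A\<close>, then expanding \<open>p\<^sub>e\<close> exchanges an element of \<open>A\<close> for the larger
  \<open>e\<close> without changing the closure of \<open>A\<close>. Otherwise \<open>A = (B \<union> E(B)) \<setminus> I\<close> for a basis \<open>B\<close> and some
  \<open>I \<subseteq> I(B)\<close>, and \<open>f\<close> is expanded in the \<open>p\<^sub>b\<close>, \<open>b \<in> B\<close>: a factor with \<open>b \<in> I\<close> raises \<open>a\<^sub>b\<close>, and one with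
  \<open>b \<notin> I\<close> moves into \<open>p\<^sub>Y\<close>, which lowers the degree of \<open>f\<close> by one and \<open>\<chi>(A)\<close> by at most one.

  For independence, \<open>k\<close> and \<open>J\<close> play no role: all products of \<open>p\<close> over \<open>X \<setminus> (B \<union> E(B))\<close> with a monomial in
  the internally active elements of \<open>B\<close> are jointly independent, by deletion and contraction of the
  smallest element.
\<close>

section \<open>Polynomials and the symmetric algebra\<close>

interpretation poly: vector_space poly_scale
  by (rule vector_space_poly_scale)

lemma poly_scale_mult: "poly_scale c f * g = poly_scale c (f * g)"
  by (simp add: poly_scale_conv_mult mult.assoc)

lemma mult_poly_scale: "f * poly_scale c g = poly_scale c (f * g)"
  by (simp add: poly_scale_conv_mult mult_ac)

lemma poly_scale_single: "poly_scale c (Poly_Mapping.single m d) = Poly_Mapping.single m (c * d)"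
  by (simp add: poly_scale_conv_mult mult_single)

text \<open>Claims about \<open>f * g\<close> with a fixed cofactor \<open>g\<close> become
  membership of \<open>f\<close> in a subspace, the form that
  \<open>Sym_degree_decomposition\<close> handles.\<close>

lemma subspace_mult_vimage:
  assumes "poly.subspace V"
  shows "poly.subspace {f. f * g \<in> V}"
  using assms unfolding poly.subspace_def by (simp add: poly_scale_mult distrib_right)

lemma single_times_expand:
  fixes f :: "('u \<Rightarrow>\<^sub>0 nat) \<Rightarrow>\<^sub>0 'k::comm_ring_1"
  shows "Poly_Mapping.single n 1 * f =
    (\<Sum>m\<in>Poly_Mapping.keys f. Poly_Mapping.single (n + m) (Poly_Mapping.lookup f m))"
  by (subst poly_expand[of f]) (simp add: sum_distrib_left mult_single)

lemma lookup_single_times: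
  fixes f :: "('u \<Rightarrow>\<^sub>0 nat) \<Rightarrow>\<^sub>0 'k::comm_ring_1"
  shows "Poly_Mapping.lookup (Poly_Mapping.single n 1 * f) (n + m) = Poly_Mapping.lookup f m"
proof -
  have "Poly_Mapping.lookup (Poly_Mapping.single n 1 * f) (n + m) =
     (\<Sum>l\<in>Poly_Mapping.keys f. if l = m then Poly_Mapping.lookup f m else 0)"
    unfolding single_times_expand lookup_sum
    by (intro sum.cong) (auto simp: lookup_single when_def)
  also have "\<dots> = Poly_Mapping.lookup f m"
    by (simp add: in_keys_iff)
  finally show ?thesis .
qed

section \<open>Total degree\<close>

definition monom_deg :: "('u \<Rightarrow>\<^sub>0 nat) \<Rightarrow> nat" where
  "monom_deg m = (\<Sum>b\<in>Poly_Mapping.keys m. Poly_Mapping.lookup m b)"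

lemma deg_le_iff: "deg_le f d \<longleftrightarrow> (\<forall>m\<in>Poly_Mapping.keys f. monom_deg m \<le> d)"
  by (simp add: deg_le_def monom_deg_def)

lemma monom_deg_superset:
  assumes "finite S" "Poly_Mapping.keys m \<subseteq> S"
  shows "monom_deg m = (\<Sum>b\<in>S. Poly_Mapping.lookup m b)"
  unfolding monom_deg_def using assms by (intro sum.mono_neutral_left) (auto simp: in_keys_iff)

lemma monom_deg_add: "monom_deg (m + n) = monom_deg m + monom_deg n"
proof -
  let ?S = "Poly_Mapping.keys m \<union> Poly_Mapping.keys n"
  have "monom_deg (m + n) = (\<Sum>b\<in>?S. Poly_Mapping.lookup (m + n) b)"
    by (rule monom_deg_superset) (simp_all add: keys_add)
  also have "\<dots> = monom_deg m + monom_deg n"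
    by (simp add: lookup_add sum.distrib monom_deg_superset[of ?S])
  finally show ?thesis .
qed

lemma monom_deg_single [simp]: "monom_deg (Poly_Mapping.single b n) = n"
  by (simp add: monom_deg_def)

lemma deg_le_1: "deg_le (1 :: ('u \<Rightarrow>\<^sub>0 nat) \<Rightarrow>\<^sub>0 'k::comm_ring_1) d"
  by (simp add: deg_le_def)

lemma deg_le_mono: "deg_le f d \<Longrightarrow> d \<le> e \<Longrightarrow> deg_le f e"
  by (force simp: deg_le_def)

lemma deg_le_add: "deg_le f d \<Longrightarrow> deg_le g d \<Longrightarrow> deg_le (f + g) d"
  using keys_add[of f g] by (force simp: deg_le_iff)

lemma deg_le_sum:
  "(\<And>i. i \<in> S \<Longrightarrow> deg_le (h i) d) \<Longrightarrow> deg_le (\<Sum>i\<in>S. h i) d"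
  by (induction S rule: infinite_finite_induct) (simp_all add: deg_le_add deg_le_def[of 0])

lemma deg_le_mult:
  fixes f g :: "('u \<Rightarrow>\<^sub>0 nat) \<Rightarrow>\<^sub>0 'k::comm_ring_1"
  assumes "deg_le f d" "deg_le g e"
  shows "deg_le (f * g) (d + e)"
  using assms keys_mult[of f g]
  by (fastforce simp: deg_le_iff monom_deg_add intro: add_mono)

lemma deg_le_exists: "\<exists>d. deg_le f d"
  unfolding deg_le_iff
  by (rule exI[of _ "\<Sum>m\<in>Poly_Mapping.keys f. monom_deg m"]) (auto intro: member_le_sum)

context symmetric_algebra
begin

lemma Sym_sum: "(\<And>i. i \<in> S \<Longrightarrow> h i \<in> Sym) \<Longrightarrow> (\<Sum>i\<in>S. h i) \<in> Sym"
  by (induction S rule: infinite_finite_induct) (auto intro: Sym_subalgebra)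

lemma Sym_prod: "(\<And>i. i \<in> S \<Longrightarrow> h i \<in> Sym) \<Longrightarrow> (\<Prod>i\<in>S. h i) \<in> Sym"
  by (induction S rule: infinite_finite_induct) (auto intro: Sym_subalgebra)

lemma Sym_power: "f \<in> Sym \<Longrightarrow> f ^ n \<in> Sym"
  by (induction n) (auto intro: Sym_subalgebra)

lemma Sym_uminus: "f \<in> Sym \<Longrightarrow> - f \<in> Sym"
  by (simp add: Sym_def)

lemma single_in_Sym: "Poly_Mapping.keys m \<subseteq> Basis \<Longrightarrow> Poly_Mapping.single m c \<in> Sym"
  by (simp add: Sym_def)

lemma deg_le_lin: "deg_le (lin u) 1"
  unfolding lin_def by (intro deg_le_sum) (auto simp: deg_le_iff)

lemma deg_le_lin_power: "deg_le (lin u ^ n) n"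
proof (induction n)
  case (Suc n)
  then show ?case
    using deg_le_mult[OF deg_le_lin[of u], of "lin u ^ n" n] by simp
qed (simp add: deg_le_1)

lemma deg_le_prod_lin_power: "deg_le (\<Prod>z\<in>S. lin (g z) ^ a z) (\<Sum>z\<in>S. a z)"
  by (induction S rule: infinite_finite_induct)
    (simp_all add: deg_le_1 deg_le_mult deg_le_lin_power)

lemma lin_0: "lin 0 = 0"
  using lin_add[of 0 0] by simp

lemma lin_combination: "lin (\<Sum>i\<in>S. scale (c i) (g i)) = (\<Sum>i\<in>S. poly_scale (c i) (lin (g i)))"
  by (induction S rule: infinite_finite_induct) (simp_all add: lin_0 lin_add lin_scale)

text \<open>A monomial of degree at most \<open>d\<close> is either 1 or a basis variable times a
  monomial of degree at most \<open>d - 1\<close>. For \<open>d = 0\<close> only \<open>one\<close>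
  has to be shown; callers supply the induction on the degree.\<close>

lemma Sym_degree_decomposition:
  assumes V: "poly.subspace V" and f: "f \<in> Sym" "deg_le f d"
    and one: "1 \<in> V"
    and step: "\<And>g b t. d = Suc t \<Longrightarrow> g \<in> Sym \<Longrightarrow> deg_le g t \<Longrightarrow> b \<in> Basis \<Longrightarrow> g * lin b \<in> V"
  shows "f \<in> V"
proof -
  have mon: "Poly_Mapping.single m 1 \<in> V" if m: "Poly_Mapping.keys m \<subseteq> Basis" "monom_deg m \<le> d" for m
  proof (cases "m = 0")
    case True
    then show ?thesis using one by simp
  next
    case False
    then obtain b where b: "b \<in> Poly_Mapping.keys m"
      by (metis all_not_in_conv keys_eq_empty)
    define m' where "m' = m - Poly_Mapping.single b 1"
    have lm: "Poly_Mapping.lookup m b \<noteq> 0"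
      using b by (simp add: in_keys_iff)
    have m_eq: "m = m' + Poly_Mapping.single b 1"
      by (rule poly_mapping_eqI)
        (use lm in \<open>auto simp: m'_def lookup_add lookup_minus lookup_single when_def\<close>)
    have km: "Poly_Mapping.keys m' \<subseteq> Basis"
      using m(1) by (auto simp: m'_def in_keys_iff lookup_minus)
    have dm: "monom_deg m = Suc (monom_deg m')"
      by (simp add: m_eq monom_deg_add)
    then obtain t where t: "d = Suc t"
      using m(2) by (cases d) auto
    have "Poly_Mapping.single m' (1::'a) * lin b \<in> V"
      using step[OF t single_in_Sym[OF km, of 1], of b] b m t dm by (auto simp: deg_le_iff)
    then show ?thesis
      using b m(1) lin_basis[of b] by (auto simp: m_eq mult_single)
  qed
  have "(\<Sum>m\<in>Poly_Mapping.keys f. Poly_Mapping.single m (Poly_Mapping.lookup f m)) \<in> V"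
  proof (rule poly.subspace_sum[OF V])
    fix m assume m: "m \<in> Poly_Mapping.keys f"
    then have "Poly_Mapping.single m 1 \<in> V"
      using f by (intro mon) (auto simp: Sym_def deg_le_iff)
    from poly.subspace_scale[OF V this, of "Poly_Mapping.lookup f m"]
    show "Poly_Mapping.single m (Poly_Mapping.lookup f m) \<in> V"
      by (simp add: poly_scale_single)
  qed
  then show ?thesis
    by (simp add: poly_expand[of f, symmetric])
qed

text \<open>Functoriality of the symmetric algebra, from the universal property applied to
  \<open>lin\<close> after \<open>T\<close>. That property gives values among all polynomials only,
  so the last clause needs an induction on the degree.\<close>

lemma Sym_homomorphism:
  assumes "\<And>u v. T (u + v) = T u + T v" "\<And>c u. T (scale c u) = scale c (T u)"
  obtains \<Phi> where "\<And>u. \<Phi> (lin u) = lin (T u)" "\<Phi> 1 = 1" "\<And>f g. \<Phi> (f + g) = \<Phi> f + \<Phi> g"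
    "\<And>f g. \<Phi> (f * g) = \<Phi> f * \<Phi> g" "\<And>c f. \<Phi> (poly_scale c f) = poly_scale c (\<Phi> f)"
    "\<And>f. f \<in> Sym \<Longrightarrow> \<Phi> f \<in> Sym"
proof -
  obtain \<Phi> where \<Phi>: "\<forall>u. \<Phi> (lin u) = lin (T u)" "\<Phi> 1 = 1" "\<forall>f g. \<Phi> (f + g) = \<Phi> f + \<Phi> g"
    "\<forall>f g. \<Phi> (f * g) = \<Phi> f * \<Phi> g" "\<forall>c f. \<Phi> (poly_scale c f) = poly_scale c (\<Phi> f)"
    using Sym_universal_existence[of poly_scale "\<lambda>u. lin (T u)"]
    by (metis assms lin_add lin_scale poly_scale_mult vector_space_poly_scale)
  have z: "\<Phi> 0 = 0"
    using \<Phi>(3) by (metis add_cancel_right_left)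
  have V: "poly.subspace {f. \<Phi> f \<in> Sym}"
    using \<Phi>(3,5) z by (simp add: poly.subspace_def Sym_subalgebra)
  have "\<Phi> f \<in> Sym" if "f \<in> Sym" "deg_le f d" for f d
    using that
  proof (induction d arbitrary: f)
    case 0
    then show ?case
      using Sym_degree_decomposition[OF V 0] \<Phi>(2) by (simp add: Sym_subalgebra)
  next
    case (Suc d)
    show ?case
      using Sym_degree_decomposition[OF V Suc.prems] Suc.IH \<Phi>(1,2,4)
      by (simp add: Sym_subalgebra)
  qed
  then have "\<Phi> f \<in> Sym" if "f \<in> Sym" for f
    using that deg_le_exists by blast
  then show thesis
    using \<Phi> that by blast
qed

text \<open>For finite \<open>V\<close> this is the ideal of \<open>Sym\<close> generated by the
  forms of \<open>V\<close>. Computing modulo it is the algebraic counterpart of contracting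
  \<open>V\<close> in the matroid.\<close>

definition lin_ideal :: "'b set \<Rightarrow> (('b \<Rightarrow>\<^sub>0 nat) \<Rightarrow>\<^sub>0 'a) set" where
  "lin_ideal V = {\<Sum>v\<in>V. lin v * h v | h. range h \<subseteq> Sym}"

lemma lin_ideal_empty: "lin_ideal {} = {0}"
  using Sym_subalgebra(1) by (auto simp: lin_ideal_def intro!: exI[of _ "\<lambda>_. 0"])

lemma lin_ideal_0: "0 \<in> lin_ideal V"
  unfolding lin_ideal_def using Sym_subalgebra(1) by (auto intro!: exI[of _ "\<lambda>_. 0"])

lemma lin_ideal_add:
  assumes "f \<in> lin_ideal V" "g \<in> lin_ideal V"
  shows "f + g \<in> lin_ideal V"
proof -
  obtain h h' where "range h \<subseteq> Sym" "range h' \<subseteq> Sym"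
    "f = (\<Sum>v\<in>V. lin v * h v)" "g = (\<Sum>v\<in>V. lin v * h' v)"
    using assms by (auto simp: lin_ideal_def)
  then show ?thesis
    unfolding lin_ideal_def
    by (auto intro!: exI[of _ "\<lambda>v. h v + h' v"] Sym_subalgebra simp: distrib_left sum.distrib)
qed

lemma lin_ideal_generator:
  assumes "finite V" "v \<in> V" "g \<in> Sym"
  shows "lin v * g \<in> lin_ideal V"
proof -
  have "lin v * g = (\<Sum>w\<in>V. lin w * (if w = v then g else 0))"
    using assms(1,2) by (simp add: if_distrib[of "\<lambda>x. _ * x"] cong: if_cong)
  then show ?thesis
    unfolding lin_ideal_def using assms(3)
    by (auto simp: Sym_subalgebra intro!: exI[of _ "\<lambda>w. if w = v then g else 0"])
qed

lemma lin_ideal_sum: "(\<And>i. i \<in> S \<Longrightarrow> h i \<in> lin_ideal V) \<Longrightarrow> (\<Sum>i\<in>S. h i) \<in> lin_ideal V"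
  by (induction S rule: infinite_finite_induct) (auto intro: lin_ideal_add lin_ideal_0)

text \<open>The extra term moves to the other side: \<open>v\<close> receives the coefficient
  \<open>- g\<close>, and \<open>v \<notin> V\<close> leaves the other coefficients
  untouched.\<close>

lemma lin_ideal_insert:
  assumes "f + lin v * g \<in> lin_ideal V" "g \<in> Sym" "finite V" "v \<notin> V"
  shows "f \<in> lin_ideal (insert v V)"
proof -
  obtain h where h: "range h \<subseteq> Sym" "f + lin v * g = (\<Sum>w\<in>V. lin w * h w)"
    using assms(1) by (auto simp: lin_ideal_def)
  have "f = - (lin v * g) + (\<Sum>w\<in>V. lin w * h w)"
    unfolding h(2)[symmetric] by simp
  also have "(\<Sum>w\<in>V. lin w * h w) = (\<Sum>w\<in>V. lin w * (h(v := - g)) w)"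
    using assms(4) by (intro sum.cong) auto
  also have "- (lin v * g) + \<dots> = (\<Sum>w\<in>insert v V. lin w * (h(v := - g)) w)"
    using assms(3,4) by simp
  finally show ?thesis
    unfolding lin_ideal_def using h(1) Sym_uminus[OF assms(2)]
    by (auto intro!: exI[of _ "h(v := - g)"])
qed

text \<open>Multiplying by a variable makes it occur in every monomial; conversely, such a variable
  can be split off each monomial of \<open>f\<close>. So ideals generated by variables are monomial
  ideals.\<close>

lemma lin_ideal_Basis_iff:
  assumes "V \<subseteq> Basis" "f \<in> Sym"
  shows "f \<in> lin_ideal V \<longleftrightarrow> (\<forall>m\<in>Poly_Mapping.keys f. Poly_Mapping.keys m \<inter> V \<noteq> {})"
proof
  have fin: "finite V"
    using assms(1) finite_Basis finite_subset by blast
  show "\<forall>m\<in>Poly_Mapping.keys f. Poly_Mapping.keys m \<inter> V \<noteq> {}" if f: "f \<in> lin_ideal V"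
  proof
    obtain h where h: "f = (\<Sum>v\<in>V. lin v * h v)"
      using f by (auto simp: lin_ideal_def)
    fix m assume "m \<in> Poly_Mapping.keys f"
    then obtain v where v: "v \<in> V" "m \<in> Poly_Mapping.keys (lin v * h v)"
      unfolding h using keys_sum[of "\<lambda>v. lin v * h v" V] by blast
    then have "lin v = Poly_Mapping.single (Poly_Mapping.single v 1) 1"
      using lin_basis assms(1) by blast
    then obtain n where "m = Poly_Mapping.single v 1 + n"
      using v(2) keys_mult[of "lin v" "h v"] by auto
    then have "Poly_Mapping.lookup m v \<noteq> 0"
      by (simp add: lookup_add)
    then show "Poly_Mapping.keys m \<inter> V \<noteq> {}"
      using v(1) by (auto simp: in_keys_iff)
  qed
  show "f \<in> lin_ideal V" if f: "\<forall>m\<in>Poly_Mapping.keys f. Poly_Mapping.keys m \<inter> V \<noteq> {}"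
  proof -
    have "Poly_Mapping.single m (Poly_Mapping.lookup f m) \<in> lin_ideal V"
      if m: "m \<in> Poly_Mapping.keys f" for m
    proof -
      obtain v where v: "v \<in> V" "v \<in> Poly_Mapping.keys m"
        using f m by blast
      define n where "n = m - Poly_Mapping.single v 1"
      have "m = Poly_Mapping.single v 1 + n"
        by (rule poly_mapping_eqI)
          (use v(2) in \<open>auto simp: n_def lookup_add lookup_minus lookup_single when_def in_keys_iff\<close>)
      moreover have "Poly_Mapping.keys n \<subseteq> Basis"
      proof
        fix b assume "b \<in> Poly_Mapping.keys n"
        then have "b \<in> Poly_Mapping.keys m"
          by (auto simp: n_def in_keys_iff lookup_minus)
        then show "b \<in> Basis"
          using assms(2) m by (auto simp: Sym_def)
      qed
      moreover have "lin v = Poly_Mapping.single (Poly_Mapping.single v 1) 1"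
        using lin_basis assms(1) v(1) by blast
      ultimately show ?thesis
        using lin_ideal_generator[OF fin v(1), of "Poly_Mapping.single n (Poly_Mapping.lookup f m)"]
        by (simp add: single_in_Sym mult_single)
    qed
    then have "(\<Sum>m\<in>Poly_Mapping.keys f. Poly_Mapping.single m (Poly_Mapping.lookup f m)) \<in> lin_ideal V"
      by (rule lin_ideal_sum)
    then show ?thesis
      by (simp add: poly_expand[of f, symmetric])
  qed
qed

text \<open>Coefficients are carried over by \<open>\<Phi>\<close> and reindexed along
  \<open>inv T\<close>, which is legitimate as \<open>T\<close> is injective.\<close>

lemma lin_ideal_image:
  assumes "f \<in> lin_ideal V" "inj T"
    and "\<And>u. \<Phi> (lin u) = lin (T u)" "\<And>f g. \<Phi> (f + g) = \<Phi> f + \<Phi> g" "\<And>f g. \<Phi> (f * g) = \<Phi> f * \<Phi> g"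
    and "\<And>f. f \<in> Sym \<Longrightarrow> \<Phi> f \<in> Sym"
  shows "\<Phi> f \<in> lin_ideal (T ` V)"
proof -
  obtain h where h: "range h \<subseteq> Sym" "f = (\<Sum>v\<in>V. lin v * h v)"
    using assms(1) by (auto simp: lin_ideal_def)
  have z: "\<Phi> 0 = 0"
    using assms(4) by (metis add_cancel_right_left)
  have "\<Phi> (\<Sum>v\<in>S. lin v * h v) = (\<Sum>v\<in>S. lin (T v) * \<Phi> (h v))" for S
    by (induction S rule: infinite_finite_induct) (simp_all add: z assms(3,4,5))
  then have "\<Phi> f = (\<Sum>v\<in>V. lin (T v) * \<Phi> (h v))"
    by (simp add: h(2))
  also have "\<dots> = (\<Sum>w\<in>T ` V. lin w * \<Phi> (h (inv T w)))"
    using assms(2) by (subst sum.reindex) (auto intro: inj_on_subset)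
  finally show ?thesis
    unfolding lin_ideal_def using h(1) assms(6) by (auto intro!: exI[of _ "\<lambda>w. \<Phi> (h (inv T w))"])
qed

text \<open>
  A linear automorphism carries \<open>insert v V\<close> into \<open>Basis\<close>, where the ideal is a monomial ideal.
\<close>

lemma lin_ideal_cancel:
  assumes g: "lin v * g \<in> lin_ideal V" "g \<in> Sym" and V: "independent V" "v \<notin> span V"
  shows "g \<in> lin_ideal V"
proof -
  have indep: "independent (insert v V)"
    using V by (simp add: independent_insertI)
  interpret vector_space_pair scale scale ..
  interpret fd: finite_dimensional_vector_space_pair scale Basis scale Basis ..
  \<comment> \<open>\<open>T\<close> matches two bases of the space: an extension of
    \<open>insert v V\<close>, and \<open>Basis\<close>.\<close>
  obtain T where T: "Vector_Spaces.linear scale scale T" "bij T"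
      "bij_betw T (extend_basis (insert v V)) Basis"
    using fd.basis_change_exists'[OF independent_extend_basis[OF indep] independent_Basis
        span_extend_basis[OF indep] span_Basis refl] by blast
  interpret T: Vector_Spaces.linear scale scale T by fact
  define T' where "T' = inv T"
  have T'T: "T' (T u) = u" and TT': "T (T' u) = u" for u
    using T(2) by (simp_all add: T'_def bij_is_inj bij_is_surj surj_f_inv_f)
  have T'_add: "T' (u + w) = T' u + T' w" and T'_scale: "T' (scale c u) = scale c (T' u)" for u w c
    using T.add[of "T' u" "T' w"] T.scale[of c "T' u"] T'T TT' by metis+
  obtain \<Phi> where \<Phi>: "\<And>u. \<Phi> (lin u) = lin (T u)" "\<Phi> 1 = 1" "\<And>f g. \<Phi> (f + g) = \<Phi> f + \<Phi> g"
    "\<And>f g. \<Phi> (f * g) = \<Phi> f * \<Phi> g" "\<And>c f. \<Phi> (poly_scale c f) = poly_scale c (\<Phi> f)"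
    "\<And>f. f \<in> Sym \<Longrightarrow> \<Phi> f \<in> Sym"
    using Sym_homomorphism[of T, OF T.add T.scale] by blast
  obtain \<Psi> where \<Psi>: "\<And>u. \<Psi> (lin u) = lin (T' u)" "\<Psi> 1 = 1" "\<And>f g. \<Psi> (f + g) = \<Psi> f + \<Psi> g"
    "\<And>f g. \<Psi> (f * g) = \<Psi> f * \<Psi> g" "\<And>c f. \<Psi> (poly_scale c f) = poly_scale c (\<Psi> f)"
    "\<And>f. f \<in> Sym \<Longrightarrow> \<Psi> f \<in> Sym"
    using Sym_homomorphism[of T', OF T'_add T'_scale] by blast
  \<comment> \<open>Both sides are algebra maps fixing every \<open>lin u\<close>, so uniqueness in
    the universal property identifies them on \<open>Sym\<close>.\<close>
  have \<Psi>\<Phi>: "\<Psi> (\<Phi> f) = f" if "f \<in> Sym" for f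
    using Sym_universal_uniqueness[of "\<lambda>f. \<Psi> (\<Phi> f)" "\<lambda>f. f" lin poly_scale] that
    by (simp add: \<Phi> \<Psi> T'T)
  have TB: "T ` insert v V \<subseteq> Basis"
    using T(3) extend_basis_superset[OF indep] unfolding bij_betw_def by blast
  have Tv: "T v \<notin> T ` V"
    using T(2) V(2) span_base by (auto simp: bij_def inj_image_mem_iff)
  have "lin (T v) * \<Phi> g \<in> lin_ideal (T ` V)"
    using lin_ideal_image[OF g(1), of T \<Phi>] T(2) \<Phi> by (simp add: bij_is_inj)
  then have *: "\<forall>m\<in>Poly_Mapping.keys (lin (T v) * \<Phi> g). Poly_Mapping.keys m \<inter> T ` V \<noteq> {}"
    using lin_ideal_Basis_iff[of "T ` V" "lin (T v) * \<Phi> g"] TB g(2) \<Phi>(6)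
    by (auto simp: Sym_subalgebra)
  \<comment> \<open>The variable \<open>T v\<close> is not among the images of \<open>V\<close>, so
    multiplying a monomial by it cannot create divisibility by one of these.\<close>
  have "Poly_Mapping.keys m \<inter> T ` V \<noteq> {}" if m: "m \<in> Poly_Mapping.keys (\<Phi> g)" for m
  proof -
    have "lin (T v) = Poly_Mapping.single (Poly_Mapping.single (T v) 1) 1"
      using lin_basis TB by blast
    then have "Poly_Mapping.single (T v) 1 + m \<in> Poly_Mapping.keys (lin (T v) * \<Phi> g)"
      using m by (simp add: in_keys_iff lookup_single_times)
    then obtain w where w: "w \<in> Poly_Mapping.keys (Poly_Mapping.single (T v) 1 + m)" "w \<in> T ` V"
      using * by blast
    from subsetD[OF keys_add w(1)] have "w = T v \<or> w \<in> Poly_Mapping.keys m"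
      by (simp split: if_splits)
    then show ?thesis
      using Tv w(2) by blast
  qed
  then have "\<Phi> g \<in> lin_ideal (T ` V)"
    using lin_ideal_Basis_iff[of "T ` V" "\<Phi> g"] TB g(2) \<Phi>(6) by auto
  then have "\<Psi> (\<Phi> g) \<in> lin_ideal (T' ` T ` V)"
    using lin_ideal_image[of "\<Phi> g" "T ` V" T' \<Psi>] T(2) \<Psi> bij_imp_bij_inv[OF T(2)]
    by (simp add: bij_is_inj T'_def)
  then show ?thesis
    using \<Psi>\<Phi>[OF g(2)] by (simp add: image_image T'T)
qed

text \<open>Every form, and hence every multiple of it, has zero constant term. This settles the
  last stage of the independence induction, where only a scalar is left.\<close>

lemma const_not_in_lin_ideal:
  assumes "poly_scale c 1 \<in> lin_ideal V"
  shows "c = 0"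
proof -
  obtain h where h: "poly_scale c 1 = (\<Sum>v\<in>V. lin v * h v)"
    using assms by (auto simp: lin_ideal_def)
  have "0 \<notin> Poly_Mapping.keys (lin v * f)" for v f
  proof
    assume "0 \<in> Poly_Mapping.keys (lin v * f)"
    then obtain m n where mn: "m \<in> Poly_Mapping.keys (lin v)" "0 = m + n"
      using keys_mult[of "lin v" f] by blast
    from mn(1) obtain b where "m = Poly_Mapping.single b 1"
      unfolding lin_def
      using keys_sum[of "\<lambda>b. Poly_Mapping.single (Poly_Mapping.single b 1) (representation Basis v b)" Basis]
      by (fastforce split: if_splits)
    moreover have "Poly_Mapping.lookup (m + n) b = 0"
      unfolding mn(2)[symmetric] by simp
    ultimately show False
      by (simp add: lookup_add)
  qed
  then have "Poly_Mapping.lookup (\<Sum>v\<in>V. lin v * h v) 0 = 0"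
    by (simp add: lookup_sum in_keys_iff)
  then show "c = 0"
    unfolding h[symmetric] by simp
qed

end

section \<open>Bases and activities\<close>

context symmetric_algebra
begin

section \<open>Spans and independence of subsequences\<close>

abbreviation sp :: "'b list \<Rightarrow> nat set \<Rightarrow> 'b set" where
  "sp X Y \<equiv> span ((!) X ` Y)"

lemma sp_mono: "Y \<subseteq> Z \<Longrightarrow> sp X Y \<subseteq> sp X Z"
  by (intro span_mono image_mono)

lemma sp_base: "y \<in> Y \<Longrightarrow> X ! y \<in> sp X Y"
  by (simp add: span_base)

lemma sp_least: "(\<And>y. y \<in> Y \<Longrightarrow> X ! y \<in> sp X Z) \<Longrightarrow> sp X Y \<subseteq> sp X Z"
  by (intro span_minimal) (auto simp: subspace_span)

lemma in_clos_iff: "z \<in> clos X Y \<longleftrightarrow> z < length X \<and> X ! z \<in> sp X Y"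
  by (auto simp: clos_def seq_rank_def dim_insert)

text \<open>Injectivity is included because \<open>X\<close> may repeat a vector, which the image
  set alone does not reveal.\<close>

definition indep_seq :: "'b list \<Rightarrow> nat set \<Rightarrow> bool" where
  "indep_seq X Y \<longleftrightarrow> inj_on ((!) X) Y \<and> independent ((!) X ` Y)"

lemma indep_seq_empty: "indep_seq X {}"
  by (simp add: indep_seq_def independent_empty)

lemma indep_seq_insert:
  assumes "indep_seq X Y" "X ! z \<notin> sp X Y"
  shows "indep_seq X (insert z Y)"
  using assms sp_base[of _ Y X]
  by (auto simp: indep_seq_def independent_insertI)

lemma indep_seq_not_in_sp:
  assumes "indep_seq X Y" "b \<in> Y"
  shows "X ! b \<notin> sp X (Y - {b})"
proof -
  have "(!) X ` (Y - {b}) = (!) X ` Y - {X ! b}"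
    using assms by (auto simp: indep_seq_def inj_on_def)
  then show ?thesis
    using assms unfolding indep_seq_def dependent_def by auto
qed

text \<open>Coordinates with respect to the independent family \<open>B\<close> are unique, so those
  of \<open>u\<close> vanish both outside \<open>Y\<close> and outside \<open>Z\<close>.\<close>

lemma sp_Int:
  assumes "indep_seq X B" "Y \<subseteq> B" "Z \<subseteq> B" "u \<in> sp X Y" "u \<in> sp X Z"
  shows "u \<in> sp X (Y \<inter> Z)"
proof -
  have i: "independent ((!) X ` B)" "inj_on ((!) X) B"
    using assms(1) by (auto simp: indep_seq_def)
  have YZ: "(!) X ` Y \<subseteq> (!) X ` B" "(!) X ` Z \<subseteq> (!) X ` B"
    using assms(2,3) by auto
  let ?r = "representation ((!) X ` B) u"
  have rY: "?r = representation ((!) X ` Y) u" and rZ: "?r = representation ((!) X ` Z) u"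
    using representation_extend[OF i(1)] assms(4,5) YZ by blast+
  have "v \<in> (!) X ` Y \<inter> (!) X ` Z" if v: "?r v \<noteq> 0" for v
    using representation_ne_zero[OF v[unfolded rY]] representation_ne_zero[OF v[unfolded rZ]] by blast
  then have "{v. ?r v \<noteq> 0} \<subseteq> (!) X ` Y \<inter> (!) X ` Z"
    by blast
  also have "\<dots> = (!) X ` (Y \<inter> Z)"
    using inj_on_image_Int[OF i(2) assms(2,3)] by simp
  finally have sub: "{v. ?r v \<noteq> 0} \<subseteq> (!) X ` (Y \<inter> Z)" .
  have "u \<in> sp X B"
    using assms(2,4) sp_mono by blast
  then have "u = (\<Sum>v | ?r v \<noteq> 0. scale (?r v) v)"
    using sum_nonzero_representation_eq[OF i(1)] by simp
  also have "\<dots> \<in> sp X (Y \<inter> Z)"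
    using sub by (intro span_sum span_scale span_base) auto
  finally show ?thesis .
qed

text \<open>Coefficients are attached to positions, so repeated entries of \<open>X\<close> need no
  special treatment.\<close>

lemma sp_coefficients:
  assumes "finite Y" "u \<in> sp X Y"
  obtains c where "u = (\<Sum>y\<in>Y. scale (c y) (X ! y))"
proof -
  have "\<exists>c. u = (\<Sum>y\<in>Y. scale (c y) (X ! y))"
    using assms
  proof (induction Y arbitrary: u rule: finite_induct)
    case (insert y Y)
    obtain l where "u - scale l (X ! y) \<in> sp X Y"
      using insert.prems by (auto simp: span_breakdown_eq)
    then obtain c where c: "u - scale l (X ! y) = (\<Sum>z\<in>Y. scale (c z) (X ! z))"
      using insert.IH by blast
    have "(\<Sum>z\<in>insert y Y. scale ((c(y := l)) z) (X ! z))
        = scale l (X ! y) + (\<Sum>z\<in>Y. scale ((c(y := l)) z) (X ! z))"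
      using insert.hyps by simp
    also have "(\<Sum>z\<in>Y. scale ((c(y := l)) z) (X ! z)) = u - scale l (X ! y)"
      unfolding c using insert.hyps by (intro sum.cong) auto
    finally show ?case
      by (metis add_diff_cancel_left' add_diff_eq)
  qed simp
  then show thesis using that by blast
qed

text \<open>Steinitz exchange: as \<open>c b\<close> is nonzero, the relation can be solved for
  \<open>X ! b\<close>. In straightening this keeps \<open>chi\<close> fixed.\<close>

lemma sp_exchange:
  assumes "finite A'" "A' \<subseteq> A" "X ! e = (\<Sum>a\<in>A'. scale (c a) (X ! a))" "b \<in> A'" "c b \<noteq> 0"
  shows "sp X (insert e (A - {b})) = sp X A"
proof
  have "X ! e \<in> sp X A"
    unfolding assms(3) using assms(2) by (intro span_sum span_scale sp_base) auto
  then show "sp X (insert e (A - {b})) \<subseteq> sp X A"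
    by (intro sp_least) (auto intro: sp_base)
  let ?C = "insert e (A - {b})"
  have "(\<Sum>a\<in>A' - {b}. scale (c a) (X ! a)) \<in> sp X ?C"
    using assms(2) by (intro span_sum span_scale sp_base) auto
  moreover have "scale (c b) (X ! b) = X ! e - (\<Sum>a\<in>A' - {b}. scale (c a) (X ! a))"
    using assms by (simp add: sum.remove)
  ultimately have "scale (c b) (X ! b) \<in> sp X ?C"
    by (simp add: span_diff sp_base del: image_insert)
  then have "scale (1 / c b) (scale (c b) (X ! b)) \<in> sp X ?C"
    by (rule span_scale)
  then have "X ! b \<in> sp X ?C"
    using assms(5) by simp
  then show "sp X A \<subseteq> sp X ?C"
  proof (intro sp_least)
    fix y assume "y \<in> A"
    with \<open>X ! b \<in> sp X ?C\<close> show "X ! y \<in> sp X ?C"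
      using sp_base[of y ?C X] by (cases "y = b") (simp_all del: image_insert)
  qed
qed

text \<open>Full rank forces spanning, and a spanning set has at least \<open>dim UNIV\<close>
  vectors. As \<open>B\<close> has exactly that many positions, no vector is repeated and
  independence follows.\<close>

lemma seq_bases_iff:
  "B \<in> seq_bases X \<longleftrightarrow> B \<subseteq> {..<length X} \<and> indep_seq X B \<and> sp X B = UNIV"
proof (cases "B \<subseteq> {..<length X}")
  case B: True
  then have fin: "finite B"
    using finite_subset by blast
  show ?thesis
  proof
    assume "B \<in> seq_bases X"
    then have card: "card B = dim UNIV" and rk: "dim ((!) X ` B) = dim UNIV"
      by (simp_all add: seq_bases_def seq_rank_def)
    from rk have sp: "sp X B = UNIV"
      using dim_eq_full[of "(!) X ` B"] by (simp add: dimension_def)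
    have "dim UNIV \<le> card ((!) X ` B)"
      using dim_le_card[of UNIV "(!) X ` B"] fin sp by simp
    then have c: "card ((!) X ` B) = card B"
      using card card_image_le[OF fin, of "(!) X"] by simp
    then have "independent ((!) X ` B)"
      using card_eq_dim[of "(!) X ` B" UNIV] card fin sp by simp
    then show "B \<subseteq> {..<length X} \<and> indep_seq X B \<and> sp X B = UNIV"
      using B sp c fin by (simp add: indep_seq_def eq_card_imp_inj_on)
  next
    assume "B \<subseteq> {..<length X} \<and> indep_seq X B \<and> sp X B = UNIV"
    then show "B \<in> seq_bases X"
      using basis_card_eq_dim[of "(!) X ` B" UNIV]
      by (auto simp: seq_bases_def seq_rank_def indep_seq_def card_image dim_eq_card_independent)
  qed
qed (auto simp: seq_bases_def)

text \<open>Independence of \<open>B\<close> puts \<open>b\<close> itself outside the closure of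
  \<open>B - {b}\<close>, so it is the maximum there exactly when nothing larger is.\<close>

lemma int_active_iff:
  assumes "B \<in> seq_bases X"
  shows "b \<in> int_active X B \<longleftrightarrow>
    b \<in> B \<and> (\<forall>z. b < z \<longrightarrow> z < length X \<longrightarrow> X ! z \<in> sp X (B - {b}))"
proof (cases "b \<in> B")
  case True
  let ?S = "{..<length X} - clos X (B - {b})"
  have S: "z \<in> ?S \<longleftrightarrow> z < length X \<and> X ! z \<notin> sp X (B - {b})" for z
    by (auto simp: in_clos_iff)
  have "b \<in> ?S"
    using S assms True indep_seq_not_in_sp by (auto simp: seq_bases_iff)
  then have "b = Max ?S \<longleftrightarrow> (\<forall>z\<in>?S. z \<le> b)"
    by (metis Max_eqI Max_ge finite_Diff finite_lessThan)
  also have "\<dots> \<longleftrightarrow> (\<forall>z. b < z \<longrightarrow> z < length X \<longrightarrow> X ! z \<in> sp X (B - {b}))"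
    using S by (meson not_le)
  finally show ?thesis
    using True by (simp add: int_active_def)
qed (simp add: int_active_def)

lemma ext_active_iff:
  "z \<in> ext_active X B \<longleftrightarrow> z < length X \<and> z \<notin> B \<and> X ! z \<in> sp X {b \<in> B. b < z}"
proof (cases "z \<in> B")
  case False
  then have "{b \<in> B. b \<le> z} = {b \<in> B. b < z}"
    by (auto simp: le_less)
  then show ?thesis
    using False by (simp add: ext_active_def in_clos_iff)
qed (simp add: ext_active_def)

lemma clos_conv_sp: "clos X Y = {z. z < length X \<and> X ! z \<in> sp X Y}"
  by (rule set_eqI) (simp add: in_clos_iff)

lemma chi_cong: "sp X A = sp X A' \<Longrightarrow> chi X J A = chi X J A'"
  by (simp add: chi_def clos_conv_sp)

lemma chi_le_1: "chi X J A \<le> 1"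
  by (simp add: chi_def)

text \<open>
  Greedy choice: the elements of \<open>A\<close> that are independent of the smaller ones in \<open>A\<close>, completed
  to a basis by elements outside \<open>A\<close>, the largest first.
\<close>

lemma active_decomposition:
  assumes A: "A \<subseteq> {..<length X}" and X: "span (set X) = UNIV"
    and closed: "\<And>e. e < length X \<Longrightarrow> X ! e \<in> sp X {a \<in> A. a < e} \<Longrightarrow> e \<in> A"
  obtains B I where "B \<in> seq_bases X" "I \<subseteq> int_active X B" "A = (B \<union> ext_active X B) - I"
proof -
  let ?n = "length X"
  define B0 where "B0 = {a \<in> A. X ! a \<notin> sp X {b \<in> A. b < a}}"
  \<comment> \<open>The test refers to all later positions, not only the chosen ones; the downward
    induction for \<open>BI\<close> shows that this gives the same span.\<close>
  define I where "I = {y. y < ?n \<and> X ! y \<notin> sp X (A \<union> {y<..<?n})}"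
  define B where "B = B0 \<union> I"
  have B0: "indep_seq X {b \<in> B0. b < m} \<and> sp X {b \<in> B0. b < m} = sp X {a \<in> A. a < m}" for m
  proof (induction m)
    case 0
    then show ?case by (simp add: indep_seq_empty)
  next
    case (Suc m)
    have less_Suc: "{a \<in> C. a < Suc m} = (if m \<in> C then insert m {a \<in> C. a < m} else {a \<in> C. a < m})"
      for C :: "nat set"
      by (auto simp: less_Suc_eq)
    show ?case
    proof (cases "m \<in> B0")
      case True
      then have "m \<in> A" "X ! m \<notin> sp X {b \<in> B0. b < m}"
        using Suc by (auto simp: B0_def)
      then show ?thesis
        using True Suc indep_seq_insert by (simp add: less_Suc span_insert)
    next
      case False
      then have "m \<in> A \<Longrightarrow> X ! m \<in> sp X {a \<in> A. a < m}"
        by (simp add: B0_def)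
      then show ?thesis
        using False Suc by (simp add: less_Suc span_redundant)
    qed
  qed
  have B0n: "{b \<in> B0. b < ?n} = B0" "{a \<in> A. a < ?n} = A"
    using A by (auto simp: B0_def)
  have BI: "indep_seq X (B0 \<union> {y \<in> I. m \<le> y}) \<and> sp X (B0 \<union> {y \<in> I. m \<le> y}) = sp X (A \<union> {m..<?n})"
    if "m \<le> ?n" for m
    using that
  proof (induction rule: inc_induct)
    case base
    have *: "{y \<in> I. ?n \<le> y} = {}"
      by (auto simp: I_def)
    show ?case
      unfolding * using B0[of ?n] by (simp add: B0n)
  next
    case (step m)
    have A_step: "A \<union> {m..<?n} = insert m (A \<union> {Suc m..<?n})"
      using step.hyps by auto
    show ?case
    proof (cases "m \<in> I")
      case True
      then have *: "B0 \<union> {y \<in> I. m \<le> y} = insert m (B0 \<union> {y \<in> I. Suc m \<le> y})"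
        by (auto simp: le_less Suc_le_eq)
      have "X ! m \<notin> sp X (A \<union> {Suc m..<?n})"
        using True by (simp add: I_def atLeastSucLessThan_greaterThanLessThan)
      then show ?thesis
        using step.IH indep_seq_insert unfolding * A_step by (simp add: span_insert del: Un_insert_right)
    next
      case False
      then have *: "{y \<in> I. m \<le> y} = {y \<in> I. Suc m \<le> y}"
        by (metis Suc_leD le_antisym not_less_eq_eq)
      have "X ! m \<in> sp X (A \<union> {Suc m..<?n})"
        using False step.hyps by (simp add: I_def atLeastSucLessThan_greaterThanLessThan)
      then show ?thesis
        using step.IH unfolding * A_step by (simp add: span_redundant del: Un_insert_right)
    qed
  qed
  have all: "A \<union> {0..<?n} = {0..<?n}"
    using A by auto
  have setX: "(!) X ` {0..<?n} = set X"
    by (auto simp: set_conv_nth)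
  have B: "B \<in> seq_bases X"
    using BI[of 0] A X unfolding seq_bases_iff all setX B_def by (auto simp: B0_def I_def)
  then have indB: "indep_seq X B"
    by (simp add: seq_bases_iff)
  have disj: "I \<inter> A = {}"
    unfolding I_def using sp_base[of _ "A \<union> _"] by blast
  have above: "X ! z \<in> sp X (B0 \<union> {y \<in> I. Suc m \<le> y})" if "m < z" "z < ?n" for m z
    using BI[of "Suc m"] that sp_base[of z "A \<union> {Suc m..<?n}" X] by simp
  \<comment> \<open>Positions above \<open>y\<close> are spanned by \<open>B0\<close> and the
    members of \<open>I\<close> above \<open>y\<close>, a set that omits \<open>y\<close>.\<close>
  have "I \<subseteq> int_active X B"
  proof
    fix y assume y: "y \<in> I"
    then have sub: "B0 \<union> {x \<in> I. Suc y \<le> x} \<subseteq> B - {y}"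
      using disj by (auto simp: B_def B0_def)
    show "y \<in> int_active X B"
      unfolding int_active_iff[OF B]
    proof (intro conjI allI impI)
      show "y \<in> B"
        using y by (simp add: B_def)
      show "X ! z \<in> sp X (B - {y})" if "y < z" "z < ?n" for z
        using above[OF that] sp_mono[OF sub] by blast
    qed
  qed
  moreover have "A = (B \<union> ext_active X B) - I"
  proof (intro equalityI subsetI)
    fix a assume a: "a \<in> A"
    show "a \<in> (B \<union> ext_active X B) - I"
    proof (cases "a \<in> B0")
      case True
      then show ?thesis using a disj by (auto simp: B_def)
    next
      case False
      then have "X ! a \<in> sp X {b \<in> B0. b < a}"
        using a B0 by (simp add: B0_def)
      moreover have "{b \<in> B0. b < a} \<subseteq> {b \<in> B. b < a}"
        by (auto simp: B_def)
      ultimately have "X ! a \<in> sp X {b \<in> B. b < a}"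
        using sp_mono by blast
      then show ?thesis
        using a A False disj by (auto simp: ext_active_iff B_def)
    qed
  next
    fix z assume z: "z \<in> (B \<union> ext_active X B) - I"
    show "z \<in> A"
    proof (cases "z \<in> B")
      case True
      then show ?thesis using z by (auto simp: B_def B0_def)
    next
      case False
      then have zE: "z < ?n" "X ! z \<in> sp X {b \<in> B. b < z}"
        using z by (auto simp: ext_active_iff)
      \<comment> \<open>As \<open>z\<close> is not in \<open>I\<close>, it is spanned by
        \<open>B0\<close> and later members of \<open>I\<close>; external activity also spans it by
        basis elements below \<open>z\<close>. By \<open>sp_Int\<close> only elements of
        \<open>B0\<close> below \<open>z\<close> remain, which lie in \<open>A\<close>, and
        \<open>closed\<close> applies.\<close>
      have "X ! z \<in> sp X (A \<union> {Suc z..<?n})"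
        using z zE(1) by (simp add: I_def atLeastSucLessThan_greaterThanLessThan)
      then have "X ! z \<in> sp X (B0 \<union> {y \<in> I. Suc z \<le> y})"
        using BI[of "Suc z"] zE(1) by simp
      then have "X ! z \<in> sp X ({b \<in> B. b < z} \<inter> (B0 \<union> {y \<in> I. Suc z \<le> y}))"
        using zE(2) by (intro sp_Int[OF indB]) (auto simp: B_def)
      moreover have "{b \<in> B. b < z} \<inter> (B0 \<union> {y \<in> I. Suc z \<le> y}) \<subseteq> {a \<in> A. a < z}"
        by (auto simp: B0_def)
      ultimately show "z \<in> A"
        using closed[OF zE(1)] sp_mono by blast
    qed
  qed
  ultimately show thesis
    using that B by blast
qed

end

section \<open>The spanning property\<close>

context symmetric_algebra
begin

lemma p_seq_insert: "finite Y \<Longrightarrow> z \<notin> Y \<Longrightarrow> p_seq X (insert z Y) = lin (X ! z) * p_seq X Y"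
  by (simp add: p_seq_def)

lemma int_active_subset: "int_active X B \<subseteq> B"
  unfolding int_active_def by blast

text \<open>One factor of each active power moves into \<open>p_seq\<close>. The complement of its
  index set is then the set at which \<open>Gamma\<close> evaluates \<open>chi\<close>, as in the
  generators of \<open>P_space\<close>.\<close>

lemma B_element_conv:
  assumes "B \<subseteq> {..<length X}" "I \<subseteq> B"
  shows "p_seq X ({..<length X} - (B \<union> ext_active X B)) * (\<Prod>z\<in>I. lin (X ! z) ^ (a z + 1)) =
    (\<Prod>z\<in>I. lin (X ! z) ^ a z) * p_seq X ({..<length X} - ((B \<union> ext_active X B) - I))"
proof -
  let ?Y = "{..<length X} - (B \<union> ext_active X B)"
  have "finite I"
    using assms by (meson finite_lessThan finite_subset)
  have "{..<length X} - ((B \<union> ext_active X B) - I) = ?Y \<union> I"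
    using assms by auto
  moreover have "p_seq X (?Y \<union> I) = p_seq X ?Y * p_seq X I"
    unfolding p_seq_def using \<open>finite I\<close> assms by (intro prod.union_disjoint) auto
  ultimately show ?thesis
    by (simp add: p_seq_def prod.distrib mult_ac)
qed

lemma B_element_in_span:
  assumes B: "B \<in> seq_bases X" and I: "I \<subseteq> int_active X B"
    and a: "(\<Sum>z\<in>I. a z) \<le> d" "int d \<le> int k + int (chi X J ((B \<union> ext_active X B) - I)) - 1"
  shows "(\<Prod>z\<in>I. lin (X ! z) ^ a z) * p_seq X ({..<length X} - ((B \<union> ext_active X B) - I))
    \<in> poly.span (B_set X k J)"
proof -
  have IB: "I \<subseteq> B"
    using I int_active_subset by blast
  have Bn: "B \<subseteq> {..<length X}"
    using B by (simp add: seq_bases_iff)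
  have "int (\<Sum>z\<in>I. a z) \<le> int k + int (chi X J ((B \<union> ext_active X B) - I)) - 1"
    using a by linarith
  \<comment> \<open>\<open>Gamma\<close> asks for functions \<open>undefined\<close> outside
    \<open>I\<close>; restricting changes no exponent that occurs.\<close>
  then have "(B, I, restrict a I) \<in> Gamma X k J"
    using B I by (simp add: Gamma_def cong: sum.cong)
  moreover have r: "(\<Prod>z\<in>I. lin (X ! z) ^ (a z + 1)) = (\<Prod>z\<in>I. lin (X ! z) ^ (restrict a I z + 1))"
    by (intro prod.cong) auto
  ultimately have "p_seq X ({..<length X} - (B \<union> ext_active X B)) * (\<Prod>z\<in>I. lin (X ! z) ^ (a z + 1))
      \<in> B_set X k J"
    unfolding r B_set_def by blast
  then show ?thesis
    unfolding B_element_conv[OF Bn IB] by (rule poly.span_base)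
qed

text \<open>Induction on the degree \<open>t\<close> of the part of \<open>f\<close> not yet
  expanded, while \<open>a\<close> records the factors absorbed into powers over \<open>I\<close>.
  \<open>IH\<close> is the hypothesis of the outer induction on \<open>d\<close>, used for factors
  outside \<open>I\<close>.\<close>

lemma straightening_active:
  assumes B: "B \<in> seq_bases X" and I: "I \<subseteq> int_active X B"
    and A: "A = (B \<union> ext_active X B) - I"
    and d: "int d \<le> int k + int (chi X J A) - 1"
    and IH: "\<And>d' f A. \<lbrakk>d' < d; A \<subseteq> {..<length X}; f \<in> Sym; deg_le f d';
        int d' \<le> int k + int (chi X J A) - 1\<rbrakk>
      \<Longrightarrow> f * p_seq X ({..<length X} - A) \<in> poly.span (B_set X k J)"
    and f: "f \<in> Sym" "deg_le f t" and ta: "t + (\<Sum>z\<in>I. a z) \<le> d"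
  shows "f * ((\<Prod>z\<in>I. lin (X ! z) ^ a z) * p_seq X ({..<length X} - A)) \<in> poly.span (B_set X k J)"
  using f ta
proof (induction t arbitrary: f a)
  case (0 f a)
  have "(\<Prod>z\<in>I. lin (X ! z) ^ a z) * p_seq X ({..<length X} - A) \<in> poly.span (B_set X k J)"
    unfolding A using 0(3) d A by (intro B_element_in_span[of _ _ _ _ d] B I) auto
  then show ?case
    using Sym_degree_decomposition[OF subspace_mult_vimage[OF poly.subspace_span] 0(1,2)] by simp
next
  case (Suc t f a)
  let ?n = "length X" and ?M = "\<lambda>a. \<Prod>z\<in>I. lin (X ! z) ^ a z"
  let ?V = "poly.span (B_set X k J)"
  have IB: "I \<subseteq> B"
    using I int_active_subset by blast
  have Bn: "B \<subseteq> {..<?n}" and spB: "sp X B = UNIV"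
    using B by (simp_all add: seq_bases_iff)
  have finB: "finite B" and finI: "finite I"
    using Bn IB by (meson finite_lessThan finite_subset)+
  have An: "A \<subseteq> {..<?n}"
    unfolding A using Bn by (auto simp: ext_active_def)
  have step: "g * lin (X ! z) * (?M a * p_seq X ({..<?n} - A)) \<in> ?V"
    if g: "g \<in> Sym" "deg_le g t" and z: "z \<in> B" for g z
  proof (cases "z \<in> I")
    case True
    \<comment> \<open>One unit of degree passes from \<open>t\<close> to the exponent at
      \<open>z\<close>, so the bound by \<open>d\<close> persists.\<close>
    let ?a = "a(z := Suc (a z))"
    have "(\<Prod>w\<in>I - {z}. lin (X ! w) ^ ?a w) = (\<Prod>w\<in>I - {z}. lin (X ! w) ^ a w)"
      "(\<Sum>w\<in>I - {z}. ?a w) = (\<Sum>w\<in>I - {z}. a w)"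
      by (auto intro: prod.cong sum.cong)
    then have "?M ?a = lin (X ! z) * ?M a" "(\<Sum>w\<in>I. ?a w) = Suc (\<Sum>w\<in>I. a w)"
      using prod.remove[OF finI True, of "\<lambda>w. lin (X ! w) ^ ?a w"]
        prod.remove[OF finI True, of "\<lambda>w. lin (X ! w) ^ a w"]
        sum.remove[OF finI True, of ?a] sum.remove[OF finI True, of a]
      by (simp_all add: mult.assoc)
    then show ?thesis
      using Suc.IH[OF g, of ?a] Suc.prems(3) by (simp add: mult.assoc)
  next
    case False
    then have zA: "z \<in> A" "z < ?n"
      using z A Bn by auto
    have "{..<?n} - (A - {z}) = insert z ({..<?n} - A)"
      using zA by auto
    then have "p_seq X ({..<?n} - (A - {z})) = lin (X ! z) * p_seq X ({..<?n} - A)"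
      using zA by (simp add: p_seq_insert)
    moreover have "g * ?M a * p_seq X ({..<?n} - (A - {z})) \<in> ?V"
    proof (rule IH)
      show "d - 1 < d" using Suc.prems(3) by simp
      show "A - {z} \<subseteq> {..<?n}" using An by auto
      show "g * ?M a \<in> Sym"
        using g by (intro Sym_subalgebra Sym_prod Sym_power)
      have "deg_le (g * ?M a) (t + (\<Sum>z\<in>I. a z))"
        using g(2) deg_le_prod_lin_power by (rule deg_le_mult)
      then show "deg_le (g * ?M a) (d - 1)"
        using Suc.prems(3) by (elim deg_le_mono) simp
      \<comment> \<open>Since \<open>chi X J A\<close> is at most 1, \<open>d \<le> k\<close> holds,
        so the new bound is met whatever \<open>chi\<close> becomes.\<close>
      show "int (d - 1) \<le> int k + int (chi X J (A - {z})) - 1"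
        using d Suc.prems(3) chi_le_1[of X J A] by linarith
    qed
    ultimately show ?thesis
      by (simp add: mult_ac)
  qed
  show ?case
  proof (rule Sym_degree_decomposition[OF subspace_mult_vimage[OF poly.subspace_span] Suc.prems(1,2),
        unfolded mem_Collect_eq])
    show "1 * (?M a * p_seq X ({..<?n} - A)) \<in> ?V"
      unfolding A mult_1_left using Suc.prems(3) d A
      by (intro B_element_in_span[of _ _ _ _ d] B I) auto
    fix g b t' assume g: "Suc t = Suc t'" "g \<in> Sym" "deg_le g t'"
    \<comment> \<open>\<open>Basis\<close> is unrelated to \<open>X\<close>; its vectors are
      rewritten in the basis selected by \<open>B\<close>.\<close>
    have "b \<in> sp X B"
      using spB by simp
    from sp_coefficients[OF finB this] obtain c where c: "b = (\<Sum>z\<in>B. scale (c z) (X ! z))"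
      by blast
    have "g * lin b * (?M a * p_seq X ({..<?n} - A)) =
      (\<Sum>z\<in>B. poly_scale (c z) (g * lin (X ! z) * (?M a * p_seq X ({..<?n} - A))))"
      unfolding c lin_combination
      by (simp add: sum_distrib_left sum_distrib_right poly_scale_mult mult_poly_scale)
    also have "\<dots> \<in> ?V"
      using g by (intro poly.span_sum poly.span_scale step) auto
    finally show "g * lin b * (?M a * p_seq X ({..<?n} - A)) \<in> ?V" .
  qed
qed

text \<open>
  Each exchange lowers the sum of the positions outside \<open>A\<close>, so the rewriting ends.
\<close>

lemma straightening:
  assumes X: "span (set X) = UNIV"
    and "A \<subseteq> {..<length X}" "f \<in> Sym" "deg_le f d" "int d \<le> int k + int (chi X J A) - 1"
  shows "f * p_seq X ({..<length X} - A) \<in> poly.span (B_set X k J)"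
  using assms(2-)
proof (induction d arbitrary: f A rule: less_induct)
  case (less d)
  let ?n = "length X" and ?V = "poly.span (B_set X k J)"
  \<comment> \<open>Kept for the inner induction, where \<open>d\<close> and \<open>f\<close> stay
    fixed and only \<open>A\<close> moves; it becomes \<open>IH\<close> of
    \<open>straightening_active\<close>.\<close>
  note IH_d = less.IH
  show ?case
    using less.prems
  proof (induction "\<Sum>({..<?n} - A)" arbitrary: A rule: less_induct)
    case (less A)
    note A = less.prems(1)
    show ?case
    proof (cases "\<exists>e<?n. X ! e \<in> sp X {a \<in> A. a < e} \<and> e \<notin> A")
      case True
      then obtain e where e: "e < ?n" "X ! e \<in> sp X {a \<in> A. a < e}" "e \<notin> A"
        by blast
      let ?A' = "{a \<in> A. a < e}"
      define Y where "Y = {..<?n} - A - {e}"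
      have finA: "finite ?A'"
        by simp
      from sp_coefficients[OF finA e(2)]
      obtain c where c: "X ! e = (\<Sum>a\<in>?A'. scale (c a) (X ! a))"
        by blast
      have Y: "{..<?n} - A = insert e Y" "finite Y" "e \<notin> Y" and bY: "\<And>b. b \<in> ?A' \<Longrightarrow> b \<notin> Y"
        using e by (auto simp: Y_def)
      have "poly_scale (c b) (f * p_seq X (insert b Y)) \<in> ?V" if b: "b \<in> ?A'" for b
      proof (cases "c b = 0")
        case False
        let ?C = "insert e (A - {b})"
        have compl: "{..<?n} - ?C = insert b Y"
          using b e A by (auto simp: Y_def)
        have "\<Sum>({..<?n} - ?C) < \<Sum>({..<?n} - A)"
          unfolding compl Y(1) using b Y bY[OF b] by simp
        moreover have "chi X J ?C = chi X J A"
          using sp_exchange[OF finA _ c b False, of A] by (intro chi_cong) auto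
        moreover have "?C \<subseteq> {..<?n}"
          using A e by auto
        ultimately have "f * p_seq X ({..<?n} - ?C) \<in> ?V"
          using less.prems by (intro less.hyps) auto
        then show ?thesis
          unfolding compl by (rule poly.span_scale)
      qed (simp add: poly.span_zero)
      then have sum: "(\<Sum>b\<in>?A'. poly_scale (c b) (f * p_seq X (insert b Y))) \<in> ?V"
        by (rule poly.span_sum)
      have "f * p_seq X ({..<?n} - A) = f * (lin (X ! e) * p_seq X Y)"
        unfolding Y(1) using Y by (simp add: p_seq_insert)
      also have "\<dots> = (\<Sum>b\<in>?A'. f * (poly_scale (c b) (lin (X ! b)) * p_seq X Y))"
        unfolding c lin_combination by (simp add: sum_distrib_left sum_distrib_right)
      also have "\<dots> = (\<Sum>b\<in>?A'. poly_scale (c b) (f * p_seq X (insert b Y)))"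
        by (intro sum.cong refl) (simp add: p_seq_insert[OF Y(2) bY] poly_scale_mult mult_poly_scale)
      finally show ?thesis
        using sum by simp
    next
      case False
      then obtain B I where BI: "B \<in> seq_bases X" "I \<subseteq> int_active X B" "A = (B \<union> ext_active X B) - I"
        using active_decomposition[OF A X] by blast
      show ?thesis
        using straightening_active[OF BI less.prems(4) IH_d less.prems(2,3), where a = "\<lambda>_. 0"] by simp
    qed
  qed
qed

lemma P_space_subset_span_B_set:
  assumes "span (set X) = UNIV"
  shows "P_space X k J \<subseteq> poly.span (B_set X k J)"
  unfolding P_space_def
proof (rule poly.span_minimal[OF _ poly.subspace_span], rule subsetI)
  let ?n = "length X"
  fix g assume g: "g \<in> S_gen X k J"
  have compl: "{..<?n} - ({..<?n} - Y) = Y" if "Y \<subseteq> {..<?n}" for Y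
    using that by auto
  show "g \<in> poly.span (B_set X k J)"
  proof (cases "k = 0")
    case True
    then obtain Y where Y: "g = p_seq X Y" "Y \<subseteq> {..<?n}" "clos X ({..<?n} - Y) \<in> J"
      using g by (auto simp: S_gen_def)
    \<comment> \<open>The cofactor is 1, of degree 0, and \<open>chi\<close> is 1 on the complement
      of \<open>Y\<close>, so the bound reads \<open>0 \<le> 0\<close>.\<close>
    show ?thesis
      using straightening[OF assms, of "{..<?n} - Y" 1 0 k J] Y True
      by (simp add: compl Sym_subalgebra deg_le_1 chi_def)
  next
    case False
    then obtain f Y where Y: "g = f * p_seq X Y" "Y \<subseteq> {..<?n}" "f \<in> Sym"
        "deg_le f (chi X J ({..<?n} - Y) + k - 1)"
      using g by (auto simp: S_gen_def)
    then show ?thesis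
      using straightening[OF assms, of "{..<?n} - Y" f "chi X J ({..<?n} - Y) + k - 1" k J] False
      by (simp add: compl)
  qed
qed

text \<open>By \<open>B_element_conv\<close>, each element of \<open>B_set\<close> is itself a
  generator, with the power product over \<open>I\<close> as cofactor.\<close>

lemma span_B_set_subset_P_space: "poly.span (B_set X k J) \<subseteq> P_space X k J"
proof -
  have "g \<in> S_gen X k J" if g: "g \<in> B_set X k J" for g
  proof -
    let ?n = "length X"
    obtain B I a where G: "(B, I, a) \<in> Gamma X k J"
      and g_eq: "g = p_seq X ({..<?n} - (B \<union> ext_active X B)) * (\<Prod>z\<in>I. lin (X ! z) ^ (a z + 1))"
      using g by (auto simp: B_set_def)
    let ?A = "(B \<union> ext_active X B) - I" and ?f = "\<Prod>z\<in>I. lin (X ! z) ^ a z"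
    have B: "B \<subseteq> {..<?n}" and I: "I \<subseteq> B"
      and s: "int (\<Sum>z\<in>I. a z) \<le> int k + int (chi X J ?A) - 1"
      using G int_active_subset[of X B] by (auto simp: Gamma_def seq_bases_iff simp del: of_nat_sum)
    have eq: "g = ?f * p_seq X ({..<?n} - ?A)"
      unfolding g_eq by (rule B_element_conv[OF B I])
    define Z where "Z = {..<?n} - ?A"
    have Z: "Z \<subseteq> {..<?n}" "{..<?n} - Z = ?A"
      using B by (auto simp: Z_def ext_active_def)
    have finI: "finite I"
      using B I by (meson finite_lessThan finite_subset)
    show ?thesis
    proof (cases "k = 0")
      case True
      \<comment> \<open>The integer bound is now \<open>chi - 1\<close>, so a nonnegative sum forces
        \<open>chi\<close> to be 1 and the sum to be 0.\<close>
      then have "chi X J ?A = 1" "(\<Sum>z\<in>I. a z) = 0"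
        using s chi_le_1[of X J ?A] by linarith+
      then have "clos X ?A \<in> J" "?f = 1"
        using finI by (simp_all add: chi_def split: if_splits)
      then have "g = p_seq X Z" "clos X ({..<?n} - Z) \<in> J"
        unfolding Z(2) using eq by (simp_all add: Z_def)
      then show ?thesis
        unfolding S_gen_def using True Z(1) by auto
    next
      case False
      have "deg_le ?f (chi X J ({..<?n} - Z) + k - 1)"
        unfolding Z(2) using s False by (intro deg_le_mono[OF deg_le_prod_lin_power]) linarith
      moreover have "?f \<in> Sym"
        by (intro Sym_prod Sym_power Sym_subalgebra)
      moreover have "g = ?f * p_seq X Z"
        using eq by (simp add: Z_def)
      ultimately have "g \<in> {f * p_seq X Y | f Y. Y \<subseteq> {..<?n} \<and> f \<in> Sym \<and>
          deg_le f (chi X J ({..<?n} - Y) + k - 1)}"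
        using Z(1) by blast
      then show ?thesis
        unfolding S_gen_def using False by simp
    qed
  qed
  then show ?thesis
    unfolding P_space_def by (intro poly.span_mono) blast
qed

end

section \<open>Linear independence\<close>

context symmetric_algebra
begin

text \<open>The set \<open>I\<close> and its exponents are merged into one function
  \<open>c\<close>. Only positions from \<open>i\<close> on contribute, so that the factor at
  \<open>i\<close> can be stripped off.\<close>

definition tail_elem :: "'b list \<Rightarrow> nat \<Rightarrow> nat set \<Rightarrow> (nat \<Rightarrow> nat) \<Rightarrow> (('b \<Rightarrow>\<^sub>0 nat) \<Rightarrow>\<^sub>0 'a)" where
  "tail_elem X i B c =
    (\<Prod>z\<in>{i..<length X}. lin (X ! z) ^ ((if z \<in> B \<union> ext_active X B then 0 else 1) + c z))"

lemma Sym_tail_elem: "tail_elem X i B c \<in> Sym"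
  unfolding tail_elem_def by (intro Sym_prod Sym_power Sym_subalgebra)

lemma tail_elem_Suc:
  assumes "i < length X"
  shows "tail_elem X i B c =
    lin (X ! i) ^ ((if i \<in> B \<union> ext_active X B then 0 else 1) + c i) * tail_elem X (Suc i) B c"
  unfolding tail_elem_def using assms by (rule prod.atLeast_Suc_lessThan)

lemma tail_elem_upd: "tail_elem X (Suc i) B (c(i := l)) = tail_elem X (Suc i) B c"
  unfolding tail_elem_def by (intro prod.cong) auto

text \<open>The labels of the indices are required to be distinct, not the polynomials, whose
  distinctness comes out of the independence proof. \<open>F\<close> is the part below
  \<open>i\<close> common to all bases.\<close>

definition tail_family ::
    "'b list \<Rightarrow> nat \<Rightarrow> nat set \<Rightarrow> 's set \<Rightarrow> ('s \<Rightarrow> nat set) \<Rightarrow> ('s \<Rightarrow> nat \<Rightarrow> nat) \<Rightarrow> bool" where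
  "tail_family X i F S Bf cf \<longleftrightarrow> finite S \<and> inj_on (\<lambda>s. (Bf s, cf s)) S \<and>
    (\<forall>s\<in>S. Bf s \<in> seq_bases X \<and> Bf s \<inter> {..<i} = F \<and>
       (\<forall>z. cf s z \<noteq> 0 \<longrightarrow> z \<in> int_active X (Bf s) \<and> i \<le> z))"

text \<open>If \<open>i\<close> were active, \<open>B - {i}\<close> would span every position above
  \<open>i\<close>, and it contains those of \<open>B'\<close> below \<open>i\<close>. Then it would
  span all of \<open>B'\<close>, hence \<open>X ! i\<close>.\<close>

lemma not_int_active_if_avoidable:
  assumes B: "B \<in> seq_bases X" "i \<in> B" and B': "B' \<in> seq_bases X" "i \<notin> B'"
    and eq: "B \<inter> {..<i} = B' \<inter> {..<i}"
  shows "i \<notin> int_active X B"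
proof
  assume i: "i \<in> int_active X B"
  have "X ! z \<in> sp X (B - {i})" if z: "z \<in> B'" for z
  proof (cases "z < i")
    case True
    then have "z \<in> B - {i}"
      using z eq by auto
    then show ?thesis by (rule sp_base)
  next
    case False
    then have "i < z" "z < length X"
      using z B' by (auto simp: seq_bases_iff le_less)
    then show ?thesis
      using i int_active_iff[OF B(1)] by blast
  qed
  then have "sp X B' \<subseteq> sp X (B - {i})"
    by (rule sp_least)
  then have "X ! i \<in> sp X (B - {i})"
    using B'(1) by (auto simp: seq_bases_iff)
  then show False
    using indep_seq_not_in_sp B by (auto simp: seq_bases_iff)
qed

text \<open>Terms outside \<open>S0\<close> are divisible by \<open>lin (X ! i)\<close>. Modulo this
  form only \<open>S0\<close> is left, which the contraction hypothesis \<open>IH\<close>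
  annihilates. The rest may be divided by the form, a non-zero-divisor modulo the ideal of
  \<open>F\<close>.\<close>

lemma tail_family_split:
  assumes i: "i < length X" "X ! i \<notin> sp X F" and F: "finite F" "indep_seq X F"
    and fam: "tail_family X i F S Bf cf"
    and comb: "(\<Sum>s\<in>S. poly_scale (\<kappa> s) (tail_elem X i (Bf s) (cf s))) \<in> lin_ideal ((!) X ` F)"
    and IH: "\<And>S. tail_family X (Suc i) (insert i F) S Bf cf \<Longrightarrow>
      (\<Sum>s\<in>S. poly_scale (\<kappa> s) (tail_elem X (Suc i) (Bf s) (cf s))) \<in> lin_ideal ((!) X ` insert i F) \<Longrightarrow>
      \<forall>s\<in>S. \<kappa> s = 0"
  defines "S0 \<equiv> {s \<in> S. i \<in> Bf s \<and> cf s i = 0}"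
  shows "\<forall>s\<in>S0. \<kappa> s = 0"
    and "(\<Sum>s\<in>S - S0. poly_scale (\<kappa> s)
      (if i \<in> Bf s then tail_elem X i (Bf s) ((cf s)(i := cf s i - 1))
       else tail_elem X (Suc i) (Bf s) (cf s))) \<in> lin_ideal ((!) X ` F)" (is "?G \<in> _")
proof -
  let ?V = "(!) X ` F"
  let ?h = "\<lambda>s. if i \<in> Bf s then tail_elem X i (Bf s) ((cf s)(i := cf s i - 1))
       else tail_elem X (Suc i) (Bf s) (cf s)"
  have famS: "Bf s \<in> seq_bases X" "Bf s \<inter> {..<i} = F"
      "cf s z \<noteq> 0 \<Longrightarrow> z \<in> int_active X (Bf s) \<and> i \<le> z" if "s \<in> S" for s z
    using fam that by (auto simp: tail_family_def)
  have finS: "finite S"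
    using fam by (simp add: tail_family_def)
  have below: "{b \<in> Bf s. b < i} = F" if "s \<in> S" for s
    using famS(2)[OF that] by auto
  \<comment> \<open>Hence each basis avoiding \<open>i\<close> contributes a factor
    \<open>lin (X ! i)\<close>.\<close>
  have ext: "i \<notin> ext_active X (Bf s)" if "s \<in> S" for s
    using i(2) below[OF that] by (simp add: ext_active_iff)
  have T0: "tail_elem X i (Bf s) (cf s) = tail_elem X (Suc i) (Bf s) (cf s)" if "s \<in> S0" for s
    using that by (simp add: S0_def tail_elem_Suc[OF i(1)])
  have T1: "tail_elem X i (Bf s) (cf s) = lin (X ! i) * ?h s" if s: "s \<in> S - S0" for s
  proof (cases "i \<in> Bf s")
    case True
    then obtain l where "cf s i = Suc l"
      using s by (auto simp: S0_def gr0_conv_Suc)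
    then show ?thesis
      using True by (simp add: tail_elem_Suc[OF i(1)] tail_elem_upd mult.assoc)
  next
    case False
    have "cf s i = 0"
      using famS(3)[of s i] False s int_active_subset by blast
    then show ?thesis
      using False ext s by (simp add: tail_elem_Suc[OF i(1)])
  qed
  have G: "?G \<in> Sym"
    by (intro Sym_sum Sym_subalgebra) (simp add: Sym_tail_elem)
  have e1: "(\<Sum>s\<in>S - S0. poly_scale (\<kappa> s) (tail_elem X i (Bf s) (cf s))) = lin (X ! i) * ?G"
    unfolding sum_distrib_left by (intro sum.cong refl) (simp add: T1 mult_poly_scale)
  have e2: "(\<Sum>s\<in>S0. poly_scale (\<kappa> s) (tail_elem X i (Bf s) (cf s))) =
      (\<Sum>s\<in>S0. poly_scale (\<kappa> s) (tail_elem X (Suc i) (Bf s) (cf s)))" (is "_ = ?H")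
    by (intro sum.cong refl) (simp add: T0)
  have sub: "S0 \<subseteq> S"
    by (auto simp: S0_def)
  have split: "?H + lin (X ! i) * ?G \<in> lin_ideal ?V"
    using comb unfolding sum.subset_diff[OF sub finS] e1 e2 by (simp only: add.commute)
  have "?H \<in> lin_ideal (insert (X ! i) ?V)"
    using F(1) i(2) span_base[of "X ! i" ?V] by (intro lin_ideal_insert[OF split G]) auto
  moreover have "tail_family X (Suc i) (insert i F) S0 Bf cf"
    unfolding tail_family_def
  proof (intro conjI ballI allI impI)
    show "finite S0" "inj_on (\<lambda>s. (Bf s, cf s)) S0"
      using fam sub by (auto simp: tail_family_def intro: finite_subset inj_on_subset)
    fix s z assume s: "s \<in> S0"
    then have "s \<in> S" "i \<in> Bf s" "cf s i = 0"
      by (auto simp: S0_def)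
    then show "Bf s \<in> seq_bases X" "Bf s \<inter> {..<Suc i} = insert i F"
      using famS[of s] by (auto simp: lessThan_Suc)
    show "z \<in> int_active X (Bf s)" "Suc i \<le> z" if "cf s z \<noteq> 0"
      using famS(3)[OF \<open>s \<in> S\<close> that] \<open>cf s i = 0\<close> that by (auto simp: Suc_le_eq le_less)
  qed
  ultimately show \<kappa>0: "\<forall>s\<in>S0. \<kappa> s = 0"
    using IH[of S0] by simp
  then have "lin (X ! i) * ?G \<in> lin_ideal ?V"
    using split by simp
  then show "?G \<in> lin_ideal ?V"
    using lin_ideal_cancel[OF _ G] F(2) i(2) by (simp add: indep_seq_def)
qed

text \<open>
  Induction on \<open>i\<close> from above is deletion and contraction of the first remaining position: working
  modulo the ideal of \<open>F\<close> contracts \<open>F\<close>, and dividing by \<open>lin (X ! i)\<close> deletes \<open>i\<close>. If \<open>i\<close> lies in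
  every basis that remains, division lowers the exponent of \<open>lin (X ! i)\<close> instead, which is the
  inner induction.
\<close>

lemma tail_family_independent:
  assumes "i \<le> length X" "F \<subseteq> {..<i}" "indep_seq X F" "tail_family X i F S Bf cf"
    and "(\<Sum>s\<in>S. poly_scale (\<kappa> s) (tail_elem X i (Bf s) (cf s))) \<in> lin_ideal ((!) X ` F)"
  shows "\<forall>s\<in>S. \<kappa> s = 0"
  using assms
proof (induction arbitrary: F S cf rule: inc_induct)
  case base
  let ?n = "length X"
  note fam = base(3)[unfolded tail_family_def]
  have all: "Bf s = F \<and> cf s = (\<lambda>_. 0)" if s: "s \<in> S" for s
  proof -
    have B: "Bf s \<subseteq> {..<?n}" "Bf s \<inter> {..<?n} = F"
      using fam s by (auto simp: seq_bases_iff)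
    moreover have "cf s z = 0" for z
    proof (rule ccontr)
      assume "cf s z \<noteq> 0"
      then have "z \<in> Bf s" "?n \<le> z"
        using fam s int_active_subset by blast+
      then show False
        using B(1) by auto
    qed
    ultimately show ?thesis by auto
  qed
  show ?case
  proof
    fix s assume s: "s \<in> S"
    \<comment> \<open>All labels coincide once no position is left, so injectivity leaves a single
      index.\<close>
    have "S = {s}"
      using fam all s by (auto simp: inj_on_def)
    then have "poly_scale (\<kappa> s) 1 \<in> lin_ideal ((!) X ` F)"
      using base(4) by (simp add: tail_elem_def)
    then show "\<kappa> s = 0"
      by (rule const_not_in_lin_ideal)
  qed
next
  case (step i)
  note i = step.hyps(2)
  have F: "finite F" "F \<subseteq> {..<Suc i}"
    using step.prems(1) finite_subset by (auto simp: lessThan_Suc)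
  show ?case
  proof (cases "X ! i \<in> sp X F")
    case True
    \<comment> \<open>Position \<open>i\<close> is a loop after contracting \<open>F\<close>: every
      basis of the family avoids it and has it externally active, so its exponent is 0.\<close>
    have loop: "Bf s \<in> seq_bases X" "Bf s \<inter> {..<i} = F" "i \<notin> Bf s" "i \<in> ext_active X (Bf s)" "cf s i = 0"
      if s: "s \<in> S" for s
    proof -
      show B: "Bf s \<in> seq_bases X" and BF: "Bf s \<inter> {..<i} = F"
        using step.prems(3) s by (auto simp: tail_family_def)
      have "sp X F \<subseteq> sp X (Bf s - {i})"
        using BF by (intro sp_mono) auto
      then show "i \<notin> Bf s"
        using B True indep_seq_not_in_sp[of X "Bf s" i] by (auto simp: seq_bases_iff)
      moreover have "{b \<in> Bf s. b < i} = F"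
        using BF by auto
      ultimately show "i \<in> ext_active X (Bf s)"
        using True i by (simp add: ext_active_iff)
      show "cf s i = 0"
        using step.prems(3) s \<open>i \<notin> Bf s\<close> int_active_subset unfolding tail_family_def by blast
    qed
    have "tail_family X (Suc i) F S Bf cf"
      unfolding tail_family_def
    proof (intro conjI ballI allI impI)
      show "finite S" "inj_on (\<lambda>s. (Bf s, cf s)) S"
        using step.prems(3) by (simp_all add: tail_family_def)
      fix s z assume s: "s \<in> S"
      show "Bf s \<in> seq_bases X" "Bf s \<inter> {..<Suc i} = F"
        using loop(1-3)[OF s] by (auto simp: lessThan_Suc)
      show "z \<in> int_active X (Bf s)" "Suc i \<le> z" if z: "cf s z \<noteq> 0"
      proof -
        have "z \<in> int_active X (Bf s) \<and> i \<le> z"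
          using step.prems(3) s z unfolding tail_family_def by blast
        moreover have "z \<noteq> i"
          using z loop(5)[OF s] by metis
        ultimately show "z \<in> int_active X (Bf s)" "Suc i \<le> z"
          by auto
      qed
    qed
    moreover have "(\<Sum>s\<in>S. poly_scale (\<kappa> s) (tail_elem X (Suc i) (Bf s) (cf s))) =
        (\<Sum>s\<in>S. poly_scale (\<kappa> s) (tail_elem X i (Bf s) (cf s)))"
      using loop by (intro sum.cong refl) (simp add: tail_elem_Suc[OF i])
    ultimately show ?thesis
      using step.IH[OF F(2) step.prems(2)] step.prems(4) by simp
  next
    case False
    have insF: "insert i F \<subseteq> {..<Suc i}" "indep_seq X (insert i F)"
      using step.prems(1,2) False by (auto simp: lessThan_Suc intro: indep_seq_insert)
    \<comment> \<open>\<open>N\<close> strictly bounds the exponents at \<open>i\<close>. For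
      \<open>N = 0\<close> the family is empty; dividing in the coloop case lowers the bound by
      one.\<close>
    have bounded: "\<forall>s\<in>S. \<kappa> s = 0"
      if "tail_family X i F S Bf cf" "\<forall>s\<in>S. cf s i < N"
        "(\<Sum>s\<in>S. poly_scale (\<kappa> s) (tail_elem X i (Bf s) (cf s))) \<in> lin_ideal ((!) X ` F)" for N S cf
      using that
    proof (induction N arbitrary: S cf)
      case (Suc N)
      define S0 where "S0 = {s \<in> S. i \<in> Bf s \<and> cf s i = 0}"
      have IH: "\<forall>s\<in>S'. \<kappa> s = 0" if "tail_family X (Suc i) (insert i F) S' Bf cf"
        "(\<Sum>s\<in>S'. poly_scale (\<kappa> s) (tail_elem X (Suc i) (Bf s) (cf s))) \<in> lin_ideal ((!) X ` insert i F)" for S'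
        using step.IH[OF insF that] .
      note split = tail_family_split[OF i False F(1) step.prems(2) Suc.prems(1,3) IH, folded S0_def]
      have famS: "finite S" "inj_on (\<lambda>s. (Bf s, cf s)) S"
        "\<And>s. s \<in> S \<Longrightarrow> Bf s \<in> seq_bases X" "\<And>s. s \<in> S \<Longrightarrow> Bf s \<inter> {..<i} = F"
        "\<And>s z. s \<in> S \<Longrightarrow> cf s z \<noteq> 0 \<Longrightarrow> z \<in> int_active X (Bf s)"
        "\<And>s z. s \<in> S \<Longrightarrow> cf s z \<noteq> 0 \<Longrightarrow> i \<le> z"
        using Suc.prems(1) by (auto simp: tail_family_def)
      have "\<forall>s\<in>S - S0. \<kappa> s = 0"
      proof (cases "\<exists>B'\<in>seq_bases X. B' \<inter> {..<i} = F \<and> i \<notin> B'")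
        case True
        then obtain B' where B': "B' \<in> seq_bases X" "B' \<inter> {..<i} = F" "i \<notin> B'"
          by blast
        \<comment> \<open>Since \<open>B'\<close> avoids \<open>i\<close>, no basis of the family
          has \<open>i\<close> active. The exponent at \<open>i\<close> is then 0, and a basis
          containing \<open>i\<close> would belong to \<open>S0\<close>.\<close>
        have del: "i \<notin> Bf s" "cf s i = 0" if s: "s \<in> S - S0" for s
        proof -
          have "i \<notin> int_active X (Bf s)"
            using not_int_active_if_avoidable[OF famS(3) _ B'(1,3)] B'(2) famS(4) s int_active_subset
            by blast
          then show "cf s i = 0"
            using famS(5) s by blast
          then show "i \<notin> Bf s"
            using s by (simp add: S0_def)
        qed
        have "tail_family X (Suc i) F (S - S0) Bf cf"
          unfolding tail_family_def
        proof (intro conjI ballI allI impI)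
          show "finite (S - S0)" "inj_on (\<lambda>s. (Bf s, cf s)) (S - S0)"
            using famS(1,2) by (auto intro: inj_on_subset)
          fix s z assume s: "s \<in> S - S0"
          show "Bf s \<in> seq_bases X" "Bf s \<inter> {..<Suc i} = F"
            using famS(3,4)[of s] del(1)[OF s] s by (auto simp: lessThan_Suc)
          show "z \<in> int_active X (Bf s)" "Suc i \<le> z" if "cf s z \<noteq> 0"
            using famS(5,6)[of s z] del(2)[OF s] s that by (auto simp: Suc_le_eq le_less)
        qed
        moreover have "(\<Sum>s\<in>S - S0. poly_scale (\<kappa> s) (tail_elem X (Suc i) (Bf s) (cf s)))
            \<in> lin_ideal ((!) X ` F)"
          using split(2) del(1) by (simp cong: sum.cong_simp)
        ultimately show ?thesis
          by (rule step.IH[OF F(2) step.prems(2)])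
      next
        case coloop: False
        then have iB: "i \<in> Bf s" if "s \<in> S" for s
          using famS(3,4) that by blast
        define cf' where "cf' s = (cf s)(i := cf s i - 1)" for s
        \<comment> \<open>Outside \<open>S0\<close> the exponent is positive, so lowering it is
          reversible and keeps labels distinct.\<close>
        have cf: "cf s = (cf' s)(i := Suc (cf' s i))" if "s \<in> S - S0" for s
          using that iB by (auto simp: S0_def cf'_def)
        have "tail_family X i F (S - S0) Bf cf'"
          unfolding tail_family_def
        proof (intro conjI ballI allI impI)
          show "finite (S - S0)"
            using famS(1) by simp
          show "inj_on (\<lambda>s. (Bf s, cf' s)) (S - S0)"
          proof (rule inj_onI)
            fix s t assume st: "s \<in> S - S0" "t \<in> S - S0" "(Bf s, cf' s) = (Bf t, cf' t)"
            then have "cf s = cf t"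
              using cf by (metis prod.inject)
            then show "s = t"
              using st famS(2) by (auto simp: inj_on_def)
          qed
          fix s z assume s: "s \<in> S - S0"
          show "Bf s \<in> seq_bases X" "Bf s \<inter> {..<i} = F"
            using famS(3,4)[of s] s by auto
          show "z \<in> int_active X (Bf s)" "i \<le> z" if "cf' s z \<noteq> 0"
            using famS(5,6)[of s z] s that by (auto simp: cf'_def split: if_splits)
        qed
        moreover have "\<forall>s\<in>S - S0. cf' s i < N"
          using Suc.prems(2) cf by (metis DiffD1 Suc_less_eq fun_upd_same)
        moreover have "(\<Sum>s\<in>S - S0. poly_scale (\<kappa> s) (tail_elem X i (Bf s) (cf' s))) \<in> lin_ideal ((!) X ` F)"
          using split(2) iB by (simp add: cf'_def cong: sum.cong_simp)
        ultimately show ?thesis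
          by (rule Suc.IH)
      qed
      then show ?case
        using split(1) by blast
    qed simp
    have "finite S"
      using step.prems(3) by (simp add: tail_family_def)
    \<comment> \<open>The sum dominates each exponent, which supplies a suitable
      \<open>N\<close>.\<close>
    then have "\<forall>s\<in>S. cf s i < Suc (\<Sum>s\<in>S. cf s i)"
      by (auto simp: less_Suc_eq_le intro: member_le_sum)
    then show ?thesis
      by (rule bounded[OF step.prems(3) _ step.prems(4)])
  qed
qed

lemma B_set_tail_elem:
  assumes "v \<in> B_set X k J"
  obtains B c where "B \<in> seq_bases X" "\<And>z. c z \<noteq> 0 \<Longrightarrow> z \<in> int_active X B" "v = tail_elem X 0 B c"
proof -
  let ?n = "length X"
  obtain B I a where G: "(B, I, a) \<in> Gamma X k J"
    and v: "v = p_seq X ({..<?n} - (B \<union> ext_active X B)) * (\<Prod>z\<in>I. lin (X ! z) ^ (a z + 1))"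
    using assms by (auto simp: B_set_def)
  have B: "B \<in> seq_bases X" and I: "I \<subseteq> int_active X B"
    using G by (simp_all add: Gamma_def)
  have In: "I \<subseteq> {..<?n}"
    using I B int_active_subset by (fastforce simp: seq_bases_iff)
  \<comment> \<open>The shift by one makes \<open>I\<close> the support of \<open>c\<close>.\<close>
  define c where "c z = (if z \<in> I then a z + 1 else 0)" for z
  have "tail_elem X 0 B c = (\<Prod>z\<in>{..<?n}. lin (X ! z) ^ (if z \<in> B \<union> ext_active X B then 0 else 1)) *
      (\<Prod>z\<in>{..<?n}. lin (X ! z) ^ c z)"
    by (simp add: tail_elem_def power_add prod.distrib atLeast0LessThan)
  also have "(\<Prod>z\<in>{..<?n}. lin (X ! z) ^ (if z \<in> B \<union> ext_active X B then 0 else 1)) =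
      p_seq X ({..<?n} - (B \<union> ext_active X B))"
    unfolding p_seq_def by (intro prod.mono_neutral_cong_right) auto
  also have "(\<Prod>z\<in>{..<?n}. lin (X ! z) ^ c z) = (\<Prod>z\<in>I. lin (X ! z) ^ (a z + 1))"
    using In by (intro prod.mono_neutral_cong_right) (auto simp: c_def)
  finally have "v = tail_elem X 0 B c"
    unfolding v by (rule sym)
  moreover have "z \<in> int_active X B" if "c z \<noteq> 0" for z
    using that I by (auto simp: c_def split: if_splits)
  ultimately show thesis
    using that[OF B] by blast
qed

text \<open>Each vector is determined by its label, so chosen labels are distinct. The family starts
  at position 0 with \<open>F\<close> empty, where the ideal is zero.\<close>

lemma independent_B_set: "\<not> poly.dependent (B_set X k J)"
proof
  assume "poly.dependent (B_set X k J)"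
  then obtain S \<kappa> where S: "finite S" "S \<subseteq> B_set X k J" "(\<Sum>v\<in>S. poly_scale (\<kappa> v) v) = 0"
    and nz: "\<exists>v\<in>S. \<kappa> v \<noteq> 0"
    unfolding poly.dependent_explicit by blast
  have "\<exists>B c. B \<in> seq_bases X \<and> (\<forall>z. c z \<noteq> 0 \<longrightarrow> z \<in> int_active X B) \<and> v = tail_elem X 0 B c"
    if v: "v \<in> S" for v
  proof -
    from subsetD[OF S(2) v] obtain B c where "B \<in> seq_bases X" "\<And>z. c z \<noteq> 0 \<Longrightarrow> z \<in> int_active X B"
      "v = tail_elem X 0 B c"
      by (rule B_set_tail_elem) blast
    then show ?thesis by blast
  qed
  then have "\<forall>v\<in>S. \<exists>p. fst p \<in> seq_bases X \<and> (\<forall>z. snd p z \<noteq> 0 \<longrightarrow> z \<in> int_active X (fst p)) \<and>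
      v = tail_elem X 0 (fst p) (snd p)"
    by (metis fst_conv snd_conv)
  from bchoice[OF this] obtain h where h: "\<forall>v\<in>S. fst (h v) \<in> seq_bases X \<and>
      (\<forall>z. snd (h v) z \<noteq> 0 \<longrightarrow> z \<in> int_active X (fst (h v))) \<and> v = tail_elem X 0 (fst (h v)) (snd (h v))"
    by blast
  define Bf cf where "Bf v = fst (h v)" and "cf v = snd (h v)" for v
  have Bc: "Bf v \<in> seq_bases X" "cf v z \<noteq> 0 \<Longrightarrow> z \<in> int_active X (Bf v)"
    "v = tail_elem X 0 (Bf v) (cf v)" if "v \<in> S" for v z
    using h that unfolding Bf_def cf_def by blast+
  have "inj_on (\<lambda>v. (Bf v, cf v)) S"
    using Bc(3) by (intro inj_onI) (metis prod.inject)
  then have fam: "tail_family X 0 {} S Bf cf"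
    using S(1) Bc(1,2) by (auto simp: tail_family_def)
  have "(\<Sum>v\<in>S. poly_scale (\<kappa> v) (tail_elem X 0 (Bf v) (cf v))) = 0"
    using S(3) Bc(3) by (simp cong: sum.cong)
  then have "\<forall>v\<in>S. \<kappa> v = 0"
    using tail_family_independent[OF _ _ indep_seq_empty fam] by (simp add: lin_ideal_empty)
  then show False
    using nz by blast
qed

end

theorem theorem4p2:
  fixes scale :: "'k::field_char_0 \<Rightarrow> 'u::ab_group_add \<Rightarrow> 'u"
    and Basis :: "'u set" and X :: "'u list" and k :: nat and J :: "nat set set"
  assumes "symmetric_algebra scale Basis"
    and "vector_space.dim scale (UNIV :: 'u set) \<ge> 1"
    and "module.span scale (set X) = UNIV"
    and "symmetric_algebra.is_upper_set scale X J" and "J \<noteq> {}"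
  shows "\<not> module.dependent poly_scale (symmetric_algebra.B_set scale Basis X k J) \<and>
    module.span poly_scale (symmetric_algebra.B_set scale Basis X k J) =
      symmetric_algebra.P_space scale Basis X k J"
proof -
  interpret symmetric_algebra scale Basis by fact
  show ?thesis
    using independent_B_set P_space_subset_span_B_set[OF assms(3)] span_B_set_subset_P_space by blast
qed

end
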